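(* There is an absolute constant $C$ such that every finite set $S\subset\mathbb R^2$ that is not contained in a conic and has no three points on a line determines at least $\frac{1}{120}|S|^4-C|S|^3$ ordinary conics.
   Context: A conic is the zero set in $\mathbb R^2$ of a real polynomial of degree $2$ in two variables; in particular a union of two distinct lines is a conic. A conic is an ordinary conic for a finite set $S\subset\mathbb R^2$ (and $S$ is said to determine it) if it contains exactly five points of $S$ and it is the only conic containing these five points. *)

theory Defs
  imports "HOL-Analysis.Analysis"
begin

text \<open>The polynomial has total degree exactly 2, i.e. its homogeneous part of degree 2 is
  nonzero.  Degenerate zero sets (pairs of lines, a double line,
  a point, the empty set) count as conics.  A conic is a point set, not a polynomial up to scaling.\<close>

definition plane_conic :: "(real \<times> real) set \<Rightarrow> bool" where
  "plane_conic Q \<longleftrightarrow>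
    (\<exists>a b c d e f :: real. (a, b, c) \<noteq> (0, 0, 0) \<and>
      Q = {(x, y). a * x\<^sup>2 + b * x * y + c * y\<^sup>2 + d * x + e * y + f = 0})"

definition ordinary_conic :: "(real \<times> real) set \<Rightarrow> (real \<times> real) set \<Rightarrow> bool" where
  "ordinary_conic S Q \<longleftrightarrow>
    plane_conic Q \<and> card (Q \<inter> S) = 5 \<and> (\<forall>Q'. plane_conic Q' \<and> Q \<inter> S \<subseteq> Q' \<longrightarrow> Q' = Q)"

text \<open>Counting ordinary conics with \<^const>\<open>card\<close> is meaningful:\<close>

lemma finite_ordinary_conics:
  assumes "finite S"
  shows "finite {Q. ordinary_conic S Q}"
proof (rule finite_imageD)
  show "finite ((\<lambda>Q. Q \<inter> S) ` {Q. ordinary_conic S Q})"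
    by (rule finite_subset[of _ "Pow S"]) (use assms in auto)
  show "inj_on (\<lambda>Q. Q \<inter> S) {Q. ordinary_conic S Q}"
  proof (rule inj_onI)
    fix Q R
    assume "Q \<in> {Q. ordinary_conic S Q}" "R \<in> {Q. ordinary_conic S Q}"
      and eq: "Q \<inter> S = R \<inter> S"
    then have "plane_conic Q" "\<forall>Q'. plane_conic Q' \<and> R \<inter> S \<subseteq> Q' \<longrightarrow> Q' = R"
      by (simp_all add: ordinary_conic_def)
    moreover have "R \<inter> S \<subseteq> Q"
      using eq by blast
    ultimately show "Q = R"
      by blast
  qed
qed

end

theory Submission
  imports Defs
begin

text \<open>
  Write \<open>n\<close> for the number of points of \<open>S\<close>. For \<open>n \<ge> 7\<close> there are at least \<open>(n choose 4) / 5\<close>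
  ordinary conics. The proof averages the Kelly-Moser argument for ordinary lines over all triples
  of points of \<open>S\<close>.

  Fix four points \<open>a, b, c, d\<close>. The conics through \<open>a, b, c\<close> that avoid \<open>d\<close> form an affine plane,
  in which every other point of \<open>S\<close> is a line (the conics through it) and two lines are parallel
  iff their points lie on a common conic with \<open>a, b, c, d\<close>. So a line without parallels is an
  ordinary conic through \<open>a, b, c, d\<close>, and a simple crossing is an ordinary conic through
  \<open>a, b, c\<close>. At a vertex of the convex hull of all crossings with at least three lines, a middle
  line has no parallel. Hence the number of lines without parallel plus the number of simple hull
  vertices is at least 3, with one exception: exactly two lines without parallel and a hull with
  four triple vertices, two on each of these lines.

  Conversely, let \<open>\<Gamma>\<close> be the five points of an ordinary conic. Moving that conic to infinity gives
  the remaining points five coordinates, one for each \<open>g \<in> \<Gamma>\<close> (the pencil through \<open>\<Gamma> - {g}\<close>), any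
  two of which determine the point. If a simple hull vertex for \<open>a, b, c, d\<close> is the conic of
  \<open>\<Gamma> = {a, b, c, e, f}\<close>, then \<open>d\<close> is extremal in the coordinates \<open>e\<close> and \<open>f\<close>. For every pair of
  coordinates there are at most four such points, which would give the constant \<open>1/120\<close> if the
  exceptional case never occurred. In the exceptional case a coordinate of \<open>\<Gamma>\<close> has exactly two
  maximal and two minimal points, and then a pigeonhole argument shows that the bound four is
  missed for enough pairs of coordinates to compensate exactly.
\<close>

section \<open>Vectors in the plane\<close>

definition cross :: "real \<times> real \<Rightarrow> real \<times> real \<Rightarrow> real" where
  "cross u w = fst u * snd w - snd u * fst w"

definition perp :: "real \<times> real \<Rightarrow> real \<times> real" where
  "perp u = (- snd u, fst u)"

lemma inner_perp: "w \<bullet> perp u = cross u w"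
  by (simp add: cross_def perp_def inner_prod_def)

lemma perp_eq_0_iff [simp]: "perp u = 0 \<longleftrightarrow> u = 0"
  by (auto simp: perp_def prod_eq_iff)

lemma cross_self [simp]: "cross u u = 0"
  by (simp add: cross_def)

lemma cross_zero_right [simp]: "cross u 0 = 0"
  by (simp add: cross_def)

lemma cross_commute: "cross w u = - cross u w"
  by (simp add: cross_def)

lemma cross_eq_0_commute: "cross w u = 0 \<longleftrightarrow> cross u w = 0"
  by (simp add: cross_commute[of w])

lemma scaleR_eq_inner_cross: "(u \<bullet> u) *\<^sub>R w = (u \<bullet> w) *\<^sub>R u + cross u w *\<^sub>R perp u"
  by (simp add: cross_def perp_def inner_prod_def prod_eq_iff algebra_simps)

lemma inner_cross_diff:
  "(q \<bullet> u) * cross q w - (q \<bullet> w) * cross q u = (q \<bullet> q) * cross u w"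
  unfolding cross_def inner_prod_def inner_real_def by algebra

lemma cross_eq_0_iff:
  assumes "u \<noteq> 0"
  shows "cross u w = 0 \<longleftrightarrow> (\<exists>t. w = t *\<^sub>R u)"
proof
  assume "cross u w = 0"
  then have "(u \<bullet> u) *\<^sub>R w = (u \<bullet> w) *\<^sub>R u"
    by (simp add: scaleR_eq_inner_cross)
  then have "(1 / (u \<bullet> u)) *\<^sub>R ((u \<bullet> u) *\<^sub>R w) = ((u \<bullet> w) / (u \<bullet> u)) *\<^sub>R u"
    by simp
  then show "\<exists>t. w = t *\<^sub>R u"
    using assms by auto
qed (auto simp: cross_def)

lemma cross_eq_0_trans:
  assumes "v \<noteq> 0" "cross u v = 0" "cross v w = 0"
  shows "cross u w = 0"
proof -
  have "cross v u = 0"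
    using assms(2) by (simp add: cross_eq_0_commute)
  then show ?thesis
    using inner_cross_diff[of v u w] assms by simp
qed

lemma cross_eq_0_if_orthogonal:
  assumes "n \<noteq> 0" "n \<bullet> u = 0" "n \<bullet> w = 0"
  shows "cross u w = 0"
  using inner_cross_diff[of n u w] assms by simp

lemma inner_eq_cross_if_orthogonal:
  assumes "n \<noteq> 0" "u \<noteq> 0" "n \<bullet> u = 0"
  obtains k where "k \<noteq> 0" "\<And>w. n \<bullet> w = k * cross u w"
proof -
  have "cross (perp u) n = 0"
    using assms by (intro cross_eq_0_if_orthogonal[of u]) (simp_all add: inner_perp inner_commute)
  then obtain k where "n = k *\<^sub>R perp u"
    using cross_eq_0_iff[of "perp u" n] assms(2) by auto
  then show ?thesis
    using that[of k] assms(1) by (auto simp: inner_perp inner_commute[of "perp u"])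
qed

lemma opposite_cross_cases:
  assumes "cross u v \<noteq> 0" "cross v w \<noteq> 0" "cross u w \<noteq> 0"
  obtains "cross u v * cross u w < 0" | "cross v u * cross v w < 0" | "cross w u * cross w v < 0"
proof -
  have "(cross u v * cross u w) * ((cross v u * cross v w) * (cross w u * cross w v))
      = - (cross u v * cross v w * cross u w)\<^sup>2"
    by (simp add: cross_commute[of v u] cross_commute[of w] power2_eq_square)
  also have "\<dots> < 0"
    using assms by simp
  finally show ?thesis
    using that by (meson mult_nonneg_nonneg not_le)
qed

lemma in_open_segment_if_opposite:
  fixes v u :: "'a::real_vector"
  assumes "s < 0" "0 < t" "u \<noteq> 0"
  shows "v \<in> open_segment (v + s *\<^sub>R u) (v + t *\<^sub>R u)"
proof -
  define r where "r = - s / (t - s)"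
  have r: "0 < r" "r < 1" "(1 - r) * s + r * t = 0"
    using assms(1,2) by (simp_all add: r_def field_simps)
  have "v = v + ((1 - r) * s + r * t) *\<^sub>R u"
    using r(3) by simp
  also have "\<dots> = (1 - r) *\<^sub>R (v + s *\<^sub>R u) + r *\<^sub>R (v + t *\<^sub>R u)"
    by (simp add: algebra_simps)
  finally show ?thesis
    unfolding in_segment using r(1,2) assms by auto
qed

section \<open>Extremal points in several coordinates\<close>

definition extremal :: "'a set \<Rightarrow> ('a \<Rightarrow> real) \<Rightarrow> 'a set" where
  "extremal M u = {x \<in> M. (\<forall>y\<in>M. u y \<le> u x) \<or> (\<forall>y\<in>M. u x \<le> u y)}"

definition crossed :: "'a set \<Rightarrow> ('a \<Rightarrow> real) \<Rightarrow> ('a \<Rightarrow> real) \<Rightarrow> bool" where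
  "crossed M u w \<longleftrightarrow> (\<exists>p p' r r'. distinct [p, p', r, r'] \<and> extremal M u = {p, p', r, r'} \<and>
     u p = u p' \<and> u r = u r' \<and> w p = w r \<and> w p' = w r')"

lemma extremal_subset: "extremal M u \<subseteq> M"
  by (auto simp: extremal_def)

lemma extremal_affine:
  fixes c c' :: real
  assumes "\<And>x. x \<in> M \<Longrightarrow> u' x = c * u x + c'" "c \<noteq> 0"
  shows "extremal M u' = extremal M u"
proof (cases "0 < c")
  case True
  then show ?thesis
    using assms(1) by (auto simp: extremal_def)
next
  case False
  then have "c < 0"
    using assms(2) by simp
  then show ?thesis
    using assms(1) by (auto simp: extremal_def)
qed

lemma crossed_affine:
  fixes c c' e e' :: real
  assumes "crossed M u w"
    and u': "\<And>x. x \<in> M \<Longrightarrow> u' x = c * u x + c'" "c \<noteq> 0"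
    and w': "\<And>x. x \<in> M \<Longrightarrow> w' x = e * w x + e'"
  shows "crossed M u' w'"
proof -
  obtain p p' r r' where p: "distinct [p, p', r, r']" "extremal M u = {p, p', r, r'}"
      "u p = u p'" "u r = u r'" "w p = w r" "w p' = w r'"
    using assms(1) unfolding crossed_def by blast
  moreover have "{p, p', r, r'} \<subseteq> M"
    using extremal_subset[of M u] p(2) by simp
  then have "u' p = u' p'" "u' r = u' r'" "w' p = w' r" "w' p' = w' r'"
    using p(3-) u'(1) w' by auto
  moreover have "extremal M u' = {p, p', r, r'}"
    using extremal_affine[of M u' c u c'] u' p(2) by simp
  ultimately show ?thesis
    unfolding crossed_def by (intro exI[of _ p] exI[of _ p'] exI[of _ r] exI[of _ r']) simp
qed

lemma extremal_eq_endpoints: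
  assumes "u ` M \<subseteq> closed_segment s t" "s \<in> u ` M" "t \<in> u ` M"
  shows "extremal M u = {x \<in> M. u x = s \<or> u x = t}"
proof -
  have "(\<forall>y\<in>M. u y \<le> u x) \<or> (\<forall>y\<in>M. u x \<le> u y) \<longleftrightarrow> u x = s \<or> u x = t" if x: "x \<in> M" for x
  proof -
    obtain y z where yz: "y \<in> M" "u y = s" "z \<in> M" "u z = t"
      using assms(2,3) by blast
    have "(s \<le> u x' \<and> u x' \<le> t) \<or> (t \<le> u x' \<and> u x' \<le> s)" if "x' \<in> M" for x'
      using assms(1) that by (auto simp: closed_segment_eq_real_ivl split: if_splits)
    then show ?thesis
      using yz x by (smt (verit))
  qed
  then show ?thesis
    by (auto simp: extremal_def)
qed

lemma image_extremal_subset: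
  assumes "finite M"
  shows "u ` extremal M u \<subseteq> {Min (u ` M), Max (u ` M)}"
proof
  fix y assume "y \<in> u ` extremal M u"
  then obtain x where x: "x \<in> M" "y = u x" "(\<forall>z\<in>M. u z \<le> u x) \<or> (\<forall>z\<in>M. u x \<le> u z)"
    by (auto simp: extremal_def)
  from x(3) show "y \<in> {Min (u ` M), Max (u ` M)}"
  proof
    assume "\<forall>z\<in>M. u z \<le> u x"
    then have "Max (u ` M) = u x"
      using assms x(1) by (intro Max_eqI) auto
    with x show ?thesis by simp
  next
    assume "\<forall>z\<in>M. u x \<le> u z"
    then have "Min (u ` M) = u x"
      using assms x(1) by (intro Min_eqI) auto
    with x show ?thesis by simp
  qed
qed

lemma card_extremal_Int_le:
  assumes "finite M"
    and separate: "\<And>x y. x \<in> M \<Longrightarrow> y \<in> M \<Longrightarrow> u x = u y \<Longrightarrow> w x = w y \<Longrightarrow> x = y"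
  shows "card (extremal M u \<inter> extremal M w) \<le> 4"
proof -
  let ?E = "{Min (u ` M), Max (u ` M)} \<times> {Min (w ` M), Max (w ` M)}"
  have "inj_on (\<lambda>x. (u x, w x)) (extremal M u \<inter> extremal M w)"
    using extremal_subset[of M u] by (intro inj_onI separate) auto
  then have "card (extremal M u \<inter> extremal M w) \<le> card ?E"
    using image_extremal_subset[OF assms(1)] by (intro card_inj_on_le[of "\<lambda>x. (u x, w x)"]) blast+
  also have "\<dots> \<le> 2 * 2"
    unfolding card_cartesian_product by (intro mult_mono) (simp_all add: card_insert_if)
  finally show ?thesis
    by simp
qed

locale separating_coordinates =
  fixes M :: "'a set" and K :: "'k set" and u :: "'a \<Rightarrow> real" and w :: "'k \<Rightarrow> 'a \<Rightarrow> real"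
  assumes finite_M: "finite M" and finite_K: "finite K"
    and separate_base: "\<lbrakk>k \<in> K; x \<in> M; y \<in> M; u x = u y; w k x = w k y\<rbrakk> \<Longrightarrow> x = y"
    and separate: "\<lbrakk>k \<in> K; l \<in> K; k \<noteq> l; x \<in> M; y \<in> M; w k x = w k y; w l x = w l y\<rbrakk> \<Longrightarrow> x = y"
begin

definition coincident :: "'a \<Rightarrow> 'k set" where
  "coincident p = {k \<in> K. \<exists>y\<in>extremal M u. y \<noteq> p \<and> w k p = w k y}"

lemma card_coincident_le:
  assumes "distinct [p, p', r, r']" "extremal M u = {p, p', r, r'}" "u p = u p'"
  shows "card (coincident p) \<le> 2"
proof -
  define agree where "agree y = {k \<in> K. w k p = w k y}" for y
  have M: "{p, p', r, r'} \<subseteq> M"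
    using extremal_subset[of M u] assms(2) by simp
  have "coincident p \<subseteq> agree r \<union> agree r'"
    using separate_base[of _ p p'] assms M by (auto simp: coincident_def agree_def)
  moreover have fin: "finite (agree y)" for y
    using finite_K by (simp add: agree_def)
  ultimately have "card (coincident p) \<le> card (agree r \<union> agree r')"
    by (simp add: card_mono)
  also have "\<dots> \<le> card (agree r) + card (agree r')"
    by (rule card_Un_le)
  also have "card (agree y) \<le> 1" if "y \<in> {r, r'}" for y
    using separate[of _ _ p y] M that assms(1) fin by (auto simp: agree_def card_le_Suc0_iff_eq)
  then have "card (agree r) + card (agree r') \<le> 1 + 1"
    by (intro add_mono) simp_all
  finally show ?thesis
    by simp
qed

lemma extremal_subset_coincident:
  assumes "distinct [p, p', r, r']" "extremal M u = {p, p', r, r'}" "u r = u r'"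
    and k: "k \<in> K" "extremal M u \<subseteq> extremal M (w k)"
  shows "k \<in> coincident p"
proof -
  have M: "{p, p', r, r'} \<subseteq> M"
    using extremal_subset[of M u] assms(2) by simp
  have "w k ` {p, r, r'} \<subseteq> {Min (w k ` M), Max (w k ` M)}"
    using image_mono[OF k(2), of "w k"] image_extremal_subset[OF finite_M, of "w k"] assms(2)
    by auto
  moreover have "w k r \<noteq> w k r'"
    using separate_base[of k r r'] M assms(1,3) k(1) by auto
  ultimately have "w k p = w k r \<or> w k p = w k r'"
    by auto
  then show ?thesis
    using assms(1,2) k(1) by (auto simp: coincident_def)
qed

lemma crossed_coincident:
  assumes "p \<in> extremal M u" "k \<in> K" "crossed M u (w k)"
  shows "k \<in> coincident p"
proof -
  obtain q q' s s' where "distinct [q, q', s, s']" "extremal M u = {q, q', s, s'}"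
      "w k q = w k s" "w k q' = w k s'"
    using assms(3) unfolding crossed_def by blast
  then show ?thesis
    using assms(1,2) by (auto simp: coincident_def)
qed

lemma card_extremal_Int_crossed_le:
  assumes p: "distinct [p, p', r, r']" "extremal M u = {p, p', r, r'}" "u r = u r'" and k: "k \<in> K"
  shows "card (extremal M u \<inter> extremal M (w k)) + of_bool (crossed M u (w k))
    \<le> 3 + 2 * of_bool (k \<in> coincident p)"
proof -
  have ext: "card (extremal M u) = 4" "finite (extremal M u)"
    using p(1,2) by auto
  show ?thesis
  proof (cases "k \<in> coincident p")
    case True
    have "card (extremal M u \<inter> extremal M (w k)) \<le> 4"
      using card_mono[OF ext(2), of "extremal M u \<inter> extremal M (w k)"] ext(1) by simp
    then show ?thesis
      using True by simp
  next
    case False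
    then have "extremal M u \<inter> extremal M (w k) \<subset> extremal M u"
      using extremal_subset_coincident[OF p k] by blast
    then have "card (extremal M u \<inter> extremal M (w k)) < 4"
      using psubset_card_mono[OF ext(2)] ext(1) by metis
    moreover have "\<not> crossed M u (w k)"
      using False crossed_coincident[OF _ k] p(2) by blast
    ultimately show ?thesis
      by simp
  qed
qed

lemma sum_card_extremal_Int_le:
  assumes "4 \<le> card K"
  shows "(\<Sum>k\<in>K. card (extremal M u \<inter> extremal M (w k)) + of_bool (crossed M u (w k))) \<le> 4 * card K"
proof (cases "\<exists>k\<in>K. crossed M u (w k)")
  case False
  have "card (extremal M u \<inter> extremal M (w k)) + of_bool (crossed M u (w k)) \<le> 4" if "k \<in> K" for k
    using card_extremal_Int_le[OF finite_M, of u "w k"] separate_base[OF that] that False by auto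
  then show ?thesis
    using sum_bounded_above[of K _ "4::nat"] by (simp add: mult.commute)
next
  case True
  then obtain p p' r r' where p: "distinct [p, p', r, r']" "extremal M u = {p, p', r, r'}"
      "u p = u p'" "u r = u r'"
    unfolding crossed_def by blast
  have "(\<Sum>k\<in>K. card (extremal M u \<inter> extremal M (w k)) + of_bool (crossed M u (w k)))
      \<le> (\<Sum>k\<in>K. 3 + 2 * of_bool (k \<in> coincident p))"
    using card_extremal_Int_crossed_le[OF p(1,2,4)] by (rule sum_mono)
  also have "\<dots> = 3 * card K + 2 * card (coincident p)"
    using finite_K by (simp add: sum.distrib sum_distrib_left[symmetric] coincident_def Int_def)
  also have "\<dots> \<le> 4 * card K"
    using card_coincident_le[OF p(1-3)] assms by simp
  finally show ?thesis .
qed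

end

section \<open>Hulls of crossings in line arrangements\<close>

lemma card_less_3_cases:
  assumes "finite B"
  obtains "B = {}" | x where "B = {x}" | x y where "B = {x, y}" "x \<noteq> y" | "3 \<le> card B"
proof -
  consider "card B = 0" | "card B = 1" | "card B = 2" | "3 \<le> card B"
    by linarith
  then show thesis
    using that assms by cases (auto simp: card_1_singleton_iff card_2_iff)
qed

locale line_arrangement =
  fixes A :: "'i set" and normal :: "'i \<Rightarrow> real \<times> real" and shift :: "'i \<Rightarrow> real"
  assumes finite_lines: "finite A"
    and three_lines: "3 \<le> card A"
    and normal_nonzero: "i \<in> A \<Longrightarrow> normal i \<noteq> 0"
    and parallel_disjoint: "\<lbrakk>i \<in> A; j \<in> A; i \<noteq> j; cross (normal i) (normal j) = 0;
        normal i \<bullet> x + shift i = 0\<rbrakk> \<Longrightarrow> normal j \<bullet> x + shift j \<noteq> 0"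
    and not_all_parallel: "\<exists>i\<in>A. \<exists>j\<in>A. cross (normal i) (normal j) \<noteq> 0"
begin

definition form :: "'i \<Rightarrow> real \<times> real \<Rightarrow> real" where
  "form i x = normal i \<bullet> x + shift i"

definition lines_at :: "real \<times> real \<Rightarrow> 'i set" where
  "lines_at x = {i \<in> A. form i x = 0}"

definition parallel :: "'i \<Rightarrow> 'i \<Rightarrow> bool" where
  "parallel i j \<longleftrightarrow> cross (normal i) (normal j) = 0"

definition parallel_free :: "'i \<Rightarrow> bool" where
  "parallel_free q \<longleftrightarrow> q \<in> A \<and> (\<forall>j\<in>A. parallel q j \<longrightarrow> j = q)"

definition crossings :: "(real \<times> real) set" where
  "crossings = {x. \<exists>i j. i \<noteq> j \<and> {i, j} \<subseteq> lines_at x}"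

definition hull_vertices :: "(real \<times> real) set" where
  "hull_vertices = {v. v extreme_point_of (convex hull crossings)}"

definition simple_vertices :: "(real \<times> real) set" where
  "simple_vertices = {v \<in> hull_vertices. card (lines_at v) = 2}"

lemma lines_at_iff: "i \<in> lines_at x \<longleftrightarrow> i \<in> A \<and> form i x = 0"
  by (simp add: lines_at_def)

lemma finite_lines_at: "finite (lines_at x)"
  using finite_lines by (simp add: lines_at_def)

lemma form_add: "form i (x + t *\<^sub>R u) = form i x + t * (normal i \<bullet> u)"
  by (simp add: form_def inner_add_right)

lemma parallel_sym: "parallel i j \<Longrightarrow> parallel j i"
  by (simp add: parallel_def cross_eq_0_commute)

lemma parallel_trans: "\<lbrakk>j \<in> A; parallel i j; parallel j k\<rbrakk> \<Longrightarrow> parallel i k"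
  unfolding parallel_def using cross_eq_0_trans normal_nonzero by blast

lemma not_parallel_at: "\<lbrakk>i \<in> lines_at x; j \<in> lines_at x; i \<noteq> j\<rbrakk> \<Longrightarrow> \<not> parallel i j"
  unfolding parallel_def lines_at_def form_def using parallel_disjoint by blast

lemma parallel_form_eq:
  assumes "i \<in> A" "parallel i j" "form i x = 0" "form i y = 0"
  shows "form j x = form j y"
proof -
  obtain k where "normal j = k *\<^sub>R normal i"
    using assms(2) cross_eq_0_iff normal_nonzero[OF assms(1)] by (auto simp: parallel_def)
  moreover have "normal i \<bullet> x = normal i \<bullet> y"
    using assms(3,4) by (simp add: form_def)
  ultimately show ?thesis
    by (simp add: form_def)
qed

lemma lines_meet:
  assumes "i \<in> A" "j \<in> A" "\<not> parallel i j"
  obtains x where "x \<in> crossings" "form i x = 0" "form j x = 0"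
proof -
  let ?D = "cross (normal i) (normal j)"
  let ?x = "(1 / ?D) *\<^sub>R (shift i *\<^sub>R perp (normal j) - shift j *\<^sub>R perp (normal i))"
  have "?D \<noteq> 0" "i \<noteq> j"
    using assms(3) by (auto simp: parallel_def)
  then have "form i ?x = 0" "form j ?x = 0"
    by (simp_all add: form_def inner_diff_right inner_perp cross_commute[of "normal j"])
  then show ?thesis
    using that[of ?x] assms(1,2) \<open>i \<noteq> j\<close> by (auto simp: crossings_def lines_at_def)
qed

lemma line_unique:
  assumes "i \<in> lines_at x" "i \<in> lines_at y" "j \<in> lines_at x" "j \<in> lines_at y" "x \<noteq> y"
  shows "i = j"
proof (rule ccontr)
  assume "i \<noteq> j"
  have "normal i \<bullet> (x - y) = 0" "normal j \<bullet> (x - y) = 0"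
    using assms(1-4) by (simp_all add: lines_at_def form_def inner_diff_right)
  then have "parallel i j"
    using cross_eq_0_if_orthogonal[of "x - y" "normal i" "normal j"] assms(5)
    by (simp add: parallel_def inner_commute)
  then show False
    using not_parallel_at assms(1,3) \<open>i \<noteq> j\<close> by blast
qed

lemma inj_on_lines_at: "inj_on lines_at crossings"
proof (rule inj_onI)
  fix x y assume "x \<in> crossings" and eq: "lines_at x = lines_at y"
  then obtain i j where "i \<noteq> j" "i \<in> lines_at x" "j \<in> lines_at x"
    by (auto simp: crossings_def)
  then show "x = y"
    using line_unique[of i x y j] eq by auto
qed

lemma finite_crossings: "finite crossings"
proof (rule finite_imageD[OF _ inj_on_lines_at])
  show "finite (lines_at ` crossings)"
    by (rule finite_subset[of _ "Pow A"]) (auto simp: lines_at_def finite_lines)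
qed

lemma two_le_card_lines_at:
  assumes "x \<in> crossings"
  shows "2 \<le> card (lines_at x)"
proof -
  obtain i j where "i \<noteq> j" "{i, j} \<subseteq> lines_at x"
    using assms by (auto simp: crossings_def)
  then show ?thesis
    using card_mono[OF finite_lines_at, of "{i, j}" x] by simp
qed

lemma hull_vertices_subset: "hull_vertices \<subseteq> crossings"
  using extreme_point_of_convex_hull by (auto simp: hull_vertices_def)

lemma finite_hull_vertices: "finite hull_vertices"
  using hull_vertices_subset finite_crossings by (rule finite_subset)

lemma finite_simple_vertices: "finite simple_vertices"
  using finite_hull_vertices by (simp add: simple_vertices_def)

lemma convex_hull_vertices: "convex hull hull_vertices = convex hull crossings"
  using Krein_Milman_polytope[OF finite_crossings] by (simp add: hull_vertices_def)

lemma hull_vertex_not_between: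
  assumes "v \<in> hull_vertices" "v + s *\<^sub>R u \<in> crossings" "v + t *\<^sub>R u \<in> crossings" "s < 0" "0 < t"
  shows "u = 0"
proof (rule ccontr)
  assume "u \<noteq> 0"
  then have "v \<in> open_segment (v + s *\<^sub>R u) (v + t *\<^sub>R u)"
    using assms(4,5) by (rule in_open_segment_if_opposite[rotated 2])
  then show False
    using assms(1-3) hull_inc[of _ crossings convex]
    by (auto simp: hull_vertices_def extreme_point_of_def)
qed

lemma hull_vertex_beside:
  assumes "x \<in> crossings" "0 < s * form q x"
  shows "\<exists>v\<in>hull_vertices. 0 < s * form q v"
proof (rule ccontr)
  assume "\<not> ?thesis"
  then have "hull_vertices \<subseteq> {y. (s *\<^sub>R normal q) \<bullet> y \<le> - s * shift q}"
    by (force simp: form_def algebra_simps not_less)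
  then have "convex hull hull_vertices \<subseteq> {y. (s *\<^sub>R normal q) \<bullet> y \<le> - s * shift q}"
    by (intro hull_minimal convex_halfspace_le)
  moreover have "x \<in> convex hull hull_vertices"
    using assms(1) hull_inc by (simp add: convex_hull_vertices)
  ultimately show False
    using assms(2) by (auto simp: form_def algebra_simps)
qed

subsection \<open>Middle lines\<close>

definition beside :: "real \<times> real \<Rightarrow> 'i \<Rightarrow> real \<Rightarrow> 'i \<Rightarrow> bool" where
  "beside v m s l \<longleftrightarrow> (\<forall>x\<in>crossings. form l x = 0 \<longrightarrow> x \<noteq> v \<longrightarrow> 0 < s * form m x)"

definition middle :: "real \<times> real \<Rightarrow> 'i \<Rightarrow> 'i \<Rightarrow> 'i \<Rightarrow> bool" where
  "middle v m l r \<longleftrightarrow> {m, l, r} \<subseteq> lines_at v \<and> distinct [m, l, r] \<and>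
     beside v m (- 1) l \<and> beside v m 1 r"

definition middle_vertices :: "'i \<Rightarrow> (real \<times> real) set" where
  "middle_vertices q = {v \<in> hull_vertices. \<exists>l r. middle v q l r}"

definition ray :: "real \<times> real \<Rightarrow> 'i \<Rightarrow> real \<times> real \<Rightarrow> bool" where
  "ray v i u \<longleftrightarrow> u \<noteq> 0 \<and> normal i \<bullet> u = 0 \<and>
     (\<forall>x\<in>crossings. form i x = 0 \<longrightarrow> (\<exists>t\<ge>0. x = v + t *\<^sub>R u))"

lemma ray_exists:
  assumes v: "v \<in> hull_vertices" and i: "i \<in> lines_at v"
  shows "\<exists>u. ray v i u"
proof -
  have n: "normal i \<noteq> 0"
    using i normal_nonzero by (simp add: lines_at_iff)
  show ?thesis
  proof (cases "\<exists>y\<in>crossings. form i y = 0 \<and> y \<noteq> v")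
    case False
    then have "ray v i (perp (normal i))"
      using n by (auto simp: ray_def inner_perp intro: exI[of _ 0])
    then show ?thesis ..
  next
    case True
    then obtain y where y: "y \<in> crossings" "form i y = 0" "y \<noteq> v"
      by blast
    have along: "normal i \<bullet> (x - v) = 0" if "form i x = 0" for x
      using that i by (simp add: lines_at_iff form_def inner_diff_right)
    have "\<exists>t\<ge>0. x = v + t *\<^sub>R (y - v)" if x: "x \<in> crossings" "form i x = 0" for x
    proof -
      obtain t where t: "x = v + t *\<^sub>R (y - v)"
        using cross_eq_0_if_orthogonal[OF n along[OF y(2)] along[OF x(2)]] y(3)
        by (auto simp: cross_eq_0_iff diff_eq_eq add.commute)
      moreover have "\<not> t < 0"
        using hull_vertex_not_between[OF v, of t "y - v" 1] x(1) y t by auto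
      ultimately show ?thesis
        by (auto simp: not_less)
    qed
    then have "ray v i (y - v)"
      using y along[OF y(2)] by (simp add: ray_def)
    then show ?thesis ..
  qed
qed

lemma beside_if_ray:
  assumes "m \<in> lines_at v" "ray v l u" "0 < s * (normal m \<bullet> u)"
  shows "beside v m s l"
  unfolding beside_def
proof (intro ballI impI)
  fix x assume "x \<in> crossings" "form l x = 0" "x \<noteq> v"
  then obtain t where t: "x = v + t *\<^sub>R u" "0 \<le> t"
    using assms(2) by (auto simp: ray_def)
  then have "0 < t * (s * (normal m \<bullet> u))"
    using \<open>x \<noteq> v\<close> assms(3) by (cases "t = 0") simp_all
  then show "0 < s * form m x"
    using t(1) assms(1) by (simp add: form_add lines_at_iff mult.left_commute)
qed

lemma middle_if_opposite_rays:
  assumes at: "{m, l, r} \<subseteq> lines_at v" "distinct [m, l, r]"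
    and rays: "ray v m u" "ray v l u'" "ray v r u''"
    and opposite: "cross u u' * cross u u'' < 0"
  shows "middle v m l r \<or> middle v m r l"
proof -
  obtain k where k: "k \<noteq> 0" "\<And>w. normal m \<bullet> w = k * cross u w"
    using inner_eq_cross_if_orthogonal[of "normal m" u] rays(1) at(1) normal_nonzero
    by (auto simp: ray_def lines_at_iff)
  have "(normal m \<bullet> u') * (normal m \<bullet> u'') = k\<^sup>2 * (cross u u' * cross u u'')"
    by (simp add: k(2) power2_eq_square)
  then have "(normal m \<bullet> u') * (normal m \<bullet> u'') < 0"
    using k(1) opposite by (simp add: mult_less_0_iff)
  moreover have "beside v m s l" if "0 < s * (normal m \<bullet> u')" for s
    using that at(1) rays(2) by (auto intro: beside_if_ray)
  moreover have "beside v m s r" if "0 < s * (normal m \<bullet> u'')" for s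
    using that at(1) rays(3) by (auto intro: beside_if_ray)
  ultimately show ?thesis
    using at by (auto simp: middle_def mult_less_0_iff)
qed

lemma rays_independent:
  assumes "i \<in> lines_at v" "j \<in> lines_at v" "i \<noteq> j" "ray v i u" "ray v j w"
  shows "cross u w \<noteq> 0"
proof
  assume "cross u w = 0"
  then obtain t where "w = t *\<^sub>R u"
    using cross_eq_0_iff assms(4) by (auto simp: ray_def)
  then have "normal i \<bullet> w = 0"
    using assms(4) by (simp add: ray_def)
  then have "parallel i j"
    using cross_eq_0_if_orthogonal[of w "normal i" "normal j"] assms(5)
    by (simp add: parallel_def ray_def inner_commute)
  then show False
    using not_parallel_at assms(1-3) by blast
qed

lemma middle_exists:
  assumes v: "v \<in> hull_vertices" and at: "{i, j, k} \<subseteq> lines_at v" and dist: "distinct [i, j, k]"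
  obtains m l r where "middle v m l r" "{m, l, r} = {i, j, k}"
proof -
  obtain u where u: "\<And>i. i \<in> lines_at v \<Longrightarrow> ray v i (u i)"
    using ray_exists[OF v] by metis
  have "cross (u x) (u y) \<noteq> 0" if "x \<in> lines_at v" "y \<in> lines_at v" "x \<noteq> y" for x y
    using rays_independent[OF that] u that(1,2) by blast
  then have "cross (u i) (u j) \<noteq> 0" "cross (u j) (u k) \<noteq> 0" "cross (u i) (u k) \<noteq> 0"
    using at dist by auto
  then obtain m l r where m: "{m, l, r} = {i, j, k}" "distinct [m, l, r]"
    and opposite: "cross (u m) (u l) * cross (u m) (u r) < 0"
  proof (cases rule: opposite_cross_cases)
    case 1
    then show thesis
      using that[of i j k] dist by simp
  next
    case 2
    then show thesis
      using that[of j i k] dist by auto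
  next
    case 3
    then show thesis
      using that[of k i j] dist by auto
  qed
  have "{m, l, r} \<subseteq> lines_at v"
    using m(1) at by simp
  then have "middle v m l r \<or> middle v m r l"
    using m(2) opposite u by (intro middle_if_opposite_rays) auto
  then show ?thesis
    using that[of m l r] that[of m r l] m(1) by (auto simp: insert_commute)
qed

text \<open>A parallel of \<open>m\<close> would meet \<open>l\<close> and \<open>r\<close> on different sides of \<open>m\<close>.\<close>

lemma middle_parallel_free:
  assumes "middle v m l r"
  shows "parallel_free m"
  unfolding parallel_free_def
proof (intro conjI ballI impI)
  have at: "m \<in> lines_at v" "l \<in> lines_at v" "r \<in> lines_at v" "m \<noteq> l" "m \<noteq> r"
    using assms by (auto simp: middle_def)
  then have A: "m \<in> A" "l \<in> A" "r \<in> A"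
    by (simp_all add: lines_at_iff)
  show "m \<in> A"
    by (fact A)
  fix k assume k: "k \<in> A" "parallel m k"
  show "k = m"
  proof (rule ccontr)
    assume "k \<noteq> m"
    then have "form k v \<noteq> 0"
      using not_parallel_at[OF at(1), of k] k by (auto simp: lines_at_iff)
    have "\<not> parallel k l" "\<not> parallel k r"
      using parallel_trans[OF k] not_parallel_at at by blast+
    then obtain x y where x: "x \<in> crossings" "form k x = 0" "form l x = 0"
        and y: "y \<in> crossings" "form k y = 0" "form r y = 0"
      using lines_meet k(1) A by metis
    then have "form m x < 0" "0 < form m y"
      using assms \<open>form k v \<noteq> 0\<close> by (auto simp: middle_def beside_def)
    moreover have "form m x = form m y"
      using parallel_form_eq[OF k(1) parallel_sym[OF k(2)]] x y by blast
    ultimately show False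
      by simp
  qed
qed

lemma middle_verticesD:
  assumes "v \<in> middle_vertices q"
  shows "v \<in> hull_vertices" "form q v = 0" "parallel_free q"
proof -
  obtain l r where "v \<in> hull_vertices" and m: "middle v q l r"
    using assms by (auto simp: middle_vertices_def)
  moreover have "parallel_free q"
    using middle_parallel_free[OF m] .
  ultimately show "v \<in> hull_vertices" "form q v = 0" "parallel_free q"
    by (auto simp: middle_def lines_at_iff)
qed

lemma finite_middle_vertices: "finite (middle_vertices q)"
  using finite_hull_vertices by (simp add: middle_vertices_def)

lemma hull_vertex_cases:
  assumes "v \<in> hull_vertices"
  obtains "v \<in> simple_vertices" | q where "parallel_free q" "v \<in> middle_vertices q"
proof (cases "card (lines_at v) = 2")
  case True
  then show ?thesis
    using that(1) assms by (simp add: simple_vertices_def)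
next
  case False
  then have "3 \<le> card (lines_at v)"
    using two_le_card_lines_at[of v] assms hull_vertices_subset by force
  then obtain T where "T \<subseteq> lines_at v" "card T = 3"
    using obtain_subset_with_card_n by metis
  then obtain i j k where "{i, j, k} \<subseteq> lines_at v" "distinct [i, j, k]"
    by (auto simp: card_3_iff)
  then obtain m l r where m: "middle v m l r"
    using middle_exists[OF assms] by metis
  then have "v \<in> middle_vertices m"
    using assms by (auto simp: middle_vertices_def)
  with middle_parallel_free[OF m] show ?thesis
    by (rule that(2))
qed

lemma lines_at_if_middle:
  assumes v: "v \<in> hull_vertices" and m: "middle v p l r"
    and unique: "\<And>q. parallel_free q \<Longrightarrow> form q v = 0 \<Longrightarrow> q = p"
  shows "lines_at v = {p, l, r}"
proof -
  have plr: "{p, l, r} \<subseteq> lines_at v" "distinct [p, l, r]"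
    using m by (simp_all add: middle_def)
  have False if k: "k \<in> lines_at v" "k \<notin> {p, l, r}" for k
  proof -
    obtain m' l' r' where m': "middle v m' l' r'" "{m', l', r'} = {k, l, r}"
      using middle_exists[OF v, of k l r] k plr by auto
    have "form m' v = 0"
      using m'(1) by (simp add: middle_def lines_at_iff)
    then have "m' = p"
      using unique[OF middle_parallel_free[OF m'(1)]] by simp
    moreover have "m' \<in> {k, l, r}"
      using m'(2) by blast
    ultimately show False
      using k(2) plr(2) by auto
  qed
  then show ?thesis
    using plr(1) by blast
qed

lemma parallel_if_beside_opposite:
  assumes "beside v q s l" "beside w q (- s) l'" "l \<in> A" "l' \<in> A" "form l w \<noteq> 0" "form l' v \<noteq> 0"
  shows "parallel l l'"
proof (rule ccontr)
  assume "\<not> parallel l l'"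
  then obtain x where x: "x \<in> crossings" "form l x = 0" "form l' x = 0"
    using lines_meet assms(3,4) by metis
  then have "0 < s * form q x" "0 < - s * form q x"
    using assms unfolding beside_def by metis+
  then show False
    by simp
qed

lemma crossing_if_beside:
  assumes "beside v q s l" "l \<in> A" "l' \<in> A" "\<not> parallel l l'" "form l' v \<noteq> 0"
  shows "\<exists>x\<in>crossings. 0 < s * form q x"
  using assms lines_meet[OF assms(2-4)] unfolding beside_def by metis

lemma two_middle_vertices:
  assumes v: "middle v q l r" and w: "middle w q l' r'" and "v \<noteq> w"
  shows "distinct [q, l, r, l', r']" "parallel l r'" "parallel r l'"
    "\<exists>x\<in>hull_vertices. form q x < 0" "\<exists>x\<in>hull_vertices. 0 < form q x"
proof -
  have at: "q \<in> lines_at v" "l \<in> lines_at v" "r \<in> lines_at v"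
      "q \<in> lines_at w" "l' \<in> lines_at w" "r' \<in> lines_at w"
    and dist: "distinct [q, l, r]" "distinct [q, l', r']"
    using v w by (auto simp: middle_def)
  then have A: "l \<in> A" "r \<in> A" "l' \<in> A" "r' \<in> A"
    by (simp_all add: lines_at_iff)
  have "\<not> (j \<in> lines_at v \<and> j \<in> lines_at w)" if "j \<noteq> q" for j
    using line_unique[OF _ _ at(1,4) assms(3)] that by blast
  then have off: "l \<notin> lines_at w" "r \<notin> lines_at w" "l' \<notin> lines_at v" "r' \<notin> lines_at v"
    using at dist by auto
  then show "distinct [q, l, r, l', r']"
    using at dist by auto
  have nonzero: "form l w \<noteq> 0" "form r w \<noteq> 0" "form l' v \<noteq> 0" "form r' v \<noteq> 0"
    using off A by (simp_all add: lines_at_iff)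
  have beside: "beside v q (- 1) l" "beside v q 1 r" "beside w q (- 1) l'" "beside w q 1 r'"
    using v w by (simp_all add: middle_def)
  show lr': "parallel l r'" and rl': "parallel r l'"
    using parallel_if_beside_opposite[of v q "- 1" l w r']
      parallel_if_beside_opposite[of v q 1 r w l'] beside A nonzero by simp_all
  have "\<not> parallel r' l'" "\<not> parallel l' r'"
    using not_parallel_at[OF at(5,6)] not_parallel_at[OF at(6,5)] dist(2) by auto
  then have "\<not> parallel l l'" "\<not> parallel r r'"
    using parallel_trans[OF A(1) parallel_sym[OF lr']] parallel_trans[OF A(2) parallel_sym[OF rl']]
    by blast+
  then obtain x y where "x \<in> crossings" "0 < - 1 * form q x" "y \<in> crossings" "0 < 1 * form q y"
    using crossing_if_beside[OF beside(1), of l'] crossing_if_beside[OF beside(2), of r'] A nonzero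
    by blast
  then show "\<exists>x\<in>hull_vertices. form q x < 0" "\<exists>x\<in>hull_vertices. 0 < form q x"
    using hull_vertex_beside[of x "- 1" q] hull_vertex_beside[of y 1 q] by simp_all
qed

lemma hull_vertices_on_both_sides:
  assumes "2 \<le> card (middle_vertices q)"
  obtains x y where "x \<in> hull_vertices" "y \<in> hull_vertices" "form q x < 0" "0 < form q y"
proof -
  obtain T where "T \<subseteq> middle_vertices q" "card T = 2"
    using obtain_subset_with_card_n[OF assms] by metis
  then obtain v w l r l' r' where "middle v q l r" "middle w q l' r'" "v \<noteq> w"
    by (auto simp: card_2_iff middle_vertices_def)
  from two_middle_vertices(4,5)[OF this] show ?thesis
    using that by blast
qed

subsection \<open>Parallel-free lines and simple hull vertices\<close>

definition exceptional :: "'i \<Rightarrow> bool" where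
  "exceptional q \<longleftrightarrow> (\<exists>v\<in>hull_vertices. \<exists>w\<in>hull_vertices. \<exists>l r l' r'. v \<noteq> w \<and>
     distinct [q, l, r, l', r'] \<and> lines_at v = {q, l, r} \<and> lines_at w = {q, l', r'} \<and>
     parallel l l' \<and> parallel r r')"

lemma finite_parallel_free: "finite {q. parallel_free q}"
  using finite_lines by (rule finite_subset[rotated]) (auto simp: parallel_free_def)

lemma exceptional_if_two_parallel_free:
  assumes free: "{q. parallel_free q} = {p, p'}" and "simple_vertices = {}"
    and two: "2 \<le> card (middle_vertices p')"
  shows "exceptional p" "2 \<le> card (middle_vertices p)"
proof -
  have free': "q = p \<or> q = p'" if "parallel_free q" for q
    using free that by blast
  obtain v w where vw: "v \<in> hull_vertices" "w \<in> hull_vertices" "form p' v < 0" "0 < form p' w"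
    using hull_vertices_on_both_sides[OF two] by blast
  have mid: "x \<in> middle_vertices p" if "x \<in> hull_vertices" "form p' x \<noteq> 0" for x
    using that(1)
  proof (cases rule: hull_vertex_cases)
    case (2 q)
    then show ?thesis
      using free' middle_verticesD(2) that(2) by blast
  qed (use assms(2) in blast)
  have "v \<noteq> w" "{v, w} \<subseteq> middle_vertices p"
    using mid vw by auto
  then show "2 \<le> card (middle_vertices p)"
    using card_mono[OF finite_middle_vertices, of "{v, w}" p] by simp
  obtain l r l' r' where m: "middle v p l r" "middle w p l' r'"
    using \<open>{v, w} \<subseteq> middle_vertices p\<close> by (auto simp: middle_vertices_def)
  have only_p: "q = p" if "form p' x \<noteq> 0" "parallel_free q" "form q x = 0" for q x
    using free'[OF that(2)] that(1,3) by auto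
  have "form p' v \<noteq> 0" "form p' w \<noteq> 0"
    using vw(3,4) by simp_all
  then have "lines_at v = {p, l, r}" "lines_at w = {p, r', l'}"
    using lines_at_if_middle[OF vw(1) m(1) only_p] lines_at_if_middle[OF vw(2) m(2) only_p]
    by (auto simp only: insert_commute)
  moreover have "distinct [p, l, r, r', l']"
    using two_middle_vertices(1)[OF m \<open>v \<noteq> w\<close>] by auto
  ultimately show "exceptional p"
    unfolding exceptional_def using two_middle_vertices(2,3)[OF m \<open>v \<noteq> w\<close>] vw(1,2) \<open>v \<noteq> w\<close> by blast
qed

lemma concurrent_crossings:
  assumes "hull_vertices \<subseteq> {v}"
  shows "3 \<le> card {q. parallel_free q}"
proof -
  have "convex hull crossings \<subseteq> {v}"
    using hull_mono[OF assms, of convex] by (simp add: convex_hull_vertices)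
  then have X: "crossings \<subseteq> {v}"
    using hull_subset[of crossings convex] by blast
  obtain i j where ij: "i \<in> A" "j \<in> A" "\<not> parallel i j"
    using not_all_parallel by (auto simp: parallel_def)
  have through: "k \<in> lines_at v" if "k \<in> A" "l \<in> A" "\<not> parallel k l" for k l
    using lines_meet[OF that] X that(1) by (auto simp: lines_at_iff)
  have "k \<in> lines_at v" if k: "k \<in> A" for k
  proof -
    have "\<not> parallel k i \<or> \<not> parallel k j"
      using parallel_trans[OF k] parallel_sym ij(3) by blast
    then show ?thesis
      using through[OF k] ij(1,2) by blast
  qed
  then have "{q. parallel_free q} = A"
    using not_parallel_at unfolding parallel_free_def by blast
  then show ?thesis
    using three_lines by simp
qed

lemma closed_segment_form_eq_0:
  assumes "form k y = 0" "form k z \<noteq> 0" "x \<in> closed_segment y z" "form k x = 0"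
  shows "x = y"
proof -
  obtain t where t: "x = y + t *\<^sub>R (z - y)"
    using assms(3) by (auto simp: in_segment algebra_simps)
  have "normal k \<bullet> (z - y) = form k z"
    using assms(1) by (simp add: form_def inner_diff_right)
  then have "t = 0"
    using assms(1,2,4) form_add[of k y t "z - y"] t by simp
  then show ?thesis
    using t by simp
qed

lemma collinear_crossings_meet:
  assumes y: "y \<in> crossings" "y \<noteq> z" and X: "crossings \<subseteq> closed_segment y z"
    and i: "i \<in> A - lines_at y \<inter> lines_at z" and j: "j \<in> A - lines_at y \<inter> lines_at z"
    and not_parallel: "\<not> parallel i j"
    and x: "x \<in> crossings" "form i x = 0" "form j x = 0"
  shows "x = y"
proof (rule ccontr)
  assume "x \<noteq> y"
  obtain k where k: "k \<in> A" "form k y = 0" "form k z \<noteq> 0"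
  proof -
    obtain k k' where "k \<noteq> k'" "k \<in> lines_at y" "k' \<in> lines_at y"
      using y(1) by (auto simp: crossings_def)
    then have "k \<notin> lines_at z \<or> k' \<notin> lines_at z"
      using line_unique y(2) by blast
    then show thesis
      using that \<open>k \<in> lines_at y\<close> \<open>k' \<in> lines_at y\<close> by (auto simp: lines_at_iff)
  qed
  have parallel: "parallel k l"
    if l: "l \<in> A - lines_at y \<inter> lines_at z" "form l x = 0" for l
  proof (rule ccontr)
    assume "\<not> parallel k l"
    then obtain x' where x': "x' \<in> crossings" "form k x' = 0" "form l x' = 0"
      using lines_meet k(1) l(1) by blast
    then have "x' = y"
      using closed_segment_form_eq_0[OF k(2,3)] X by blast
    then have "form l y = 0" "form l z \<noteq> 0"
      using x'(3) l(1) by (auto simp: lines_at_iff)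
    then have "x = y"
      using closed_segment_form_eq_0[of l y z x] X x(1) l(2) by blast
    then show False
      using \<open>x \<noteq> y\<close> by simp
  qed
  show False
    using parallel_trans[OF k(1) parallel_sym[OF parallel[OF i x(2)]] parallel[OF j x(3)]]
      not_parallel by blast
qed

lemma collinear_crossings_parallel:
  assumes vw: "v \<in> crossings" "w \<in> crossings" "v \<noteq> w" and X: "crossings \<subseteq> closed_segment v w"
    and i: "i \<in> A - lines_at v \<inter> lines_at w" and j: "j \<in> A - lines_at v \<inter> lines_at w"
  shows "parallel i j"
proof (rule ccontr)
  assume not_parallel: "\<not> parallel i j"
  then obtain x where x: "x \<in> crossings" "form i x = 0" "form j x = 0"
    using lines_meet[of i j] i j by blast
  have "x = v"
    using collinear_crossings_meet[OF vw(1,3) X i j not_parallel x] .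
  moreover have "x = w"
    using collinear_crossings_meet[of w v i j x] vw X i j not_parallel x
    by (simp add: closed_segment_commute Int_commute)
  ultimately show False
    using vw(3) by simp
qed

lemma collinear_crossings_endpoint:
  assumes vw: "v \<in> crossings" "w \<in> crossings" "v \<noteq> w" and X: "crossings \<subseteq> closed_segment v w"
    and y: "y \<in> {v, w}"
  shows "card (lines_at y) = 2 \<and> (\<exists>h. parallel_free h)"
proof -
  let ?T = "A - lines_at v \<inter> lines_at w"
  have parallel: "parallel i j" if "i \<in> ?T" "j \<in> ?T" for i j
    using collinear_crossings_parallel[OF vw X that] .
  obtain i j where ij: "i \<noteq> j" "i \<in> lines_at y" "j \<in> lines_at y"
    using vw y by (auto simp: crossings_def)
  then have "\<not> (i \<in> ?T \<and> j \<in> ?T)"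
    using parallel not_parallel_at by blast
  then obtain h l where h: "h \<in> lines_at v" "h \<in> lines_at w" and l: "l \<in> lines_at y" "l \<noteq> h"
    using ij by (auto simp: lines_at_iff)
  have T: "k \<in> ?T" if "k \<in> A" "k \<noteq> h" for k
    using that line_unique[OF h] vw(3) by blast
  have at_y: "h \<in> lines_at y" "l \<in> A"
    using h y l by (auto simp: lines_at_iff)
  have "k = l" if k: "k \<in> lines_at y" "k \<noteq> h" for k
    using parallel[OF T T, of k l] not_parallel_at[OF k(1) l(1)] k at_y(2) l(2)
    by (auto simp: lines_at_iff)
  then have "lines_at y = {h, l}"
    using at_y(1) l(1) by blast
  moreover have "parallel_free h"
    unfolding parallel_free_def
  proof (intro conjI ballI impI)
    show "h \<in> A"
      using h by (simp add: lines_at_iff)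
    show "k = h" if k: "k \<in> A" "parallel h k" for k
      using parallel_trans[OF k, of l] parallel[OF T[OF k(1)] T[OF at_y(2) l(2)]]
        not_parallel_at[OF at_y(1) l(1)] l(2) by blast
  qed
  ultimately show ?thesis
    using l(2) by auto
qed

lemma collinear_crossings:
  assumes "hull_vertices = {v, w}" "v \<noteq> w"
  shows "3 \<le> card {q. parallel_free q} + card simple_vertices"
proof -
  have X: "crossings \<subseteq> closed_segment v w"
    using convex_hull_vertices assms(1) hull_subset[of crossings convex]
    by (simp add: segment_convex_hull)
  have vw: "v \<in> crossings" "w \<in> crossings"
    using assms(1) hull_vertices_subset by auto
  note endpoint = collinear_crossings_endpoint[OF vw assms(2) X]
  have "simple_vertices = {v, w}"
    using assms(1) endpoint by (auto simp: simple_vertices_def)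
  moreover have "0 < card {q. parallel_free q}"
    using endpoint[of v] finite_parallel_free by (auto simp: card_gt_0_iff)
  ultimately show ?thesis
    using assms(2) by simp
qed

lemma two_simple_vertices:
  assumes "3 \<le> card hull_vertices" "{q. parallel_free q} = {q}"
  shows "2 \<le> card simple_vertices"
proof -
  have cover: "v \<in> simple_vertices \<union> middle_vertices q" if "v \<in> hull_vertices" for v
    using that by (cases rule: hull_vertex_cases) (use assms(2) in auto)
  show ?thesis
  proof (cases "2 \<le> card (middle_vertices q)")
    case True
    then obtain x y where "x \<in> hull_vertices" "y \<in> hull_vertices" "form q x < 0" "0 < form q y"
      using hull_vertices_on_both_sides by blast
    then have "x \<noteq> y" "{x, y} \<subseteq> simple_vertices"
      using cover middle_verticesD(2) by fastforce+
    then show ?thesis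
      using card_mono[OF finite_simple_vertices, of "{x, y}"] by simp
  next
    case False
    have "card hull_vertices \<le> card (simple_vertices \<union> middle_vertices q)"
      using cover finite_simple_vertices finite_middle_vertices by (intro card_mono) auto
    also have "\<dots> \<le> card simple_vertices + card (middle_vertices q)"
      by (rule card_Un_le)
    finally show ?thesis
      using False assms(1) by linarith
  qed
qed

lemma two_exceptional:
  assumes "3 \<le> card hull_vertices" "simple_vertices = {}" "{q. parallel_free q} = {p, p'}"
  shows "exceptional p \<and> exceptional p'"
proof -
  have "hull_vertices \<subseteq> middle_vertices p \<union> middle_vertices p'"
  proof
    fix v assume "v \<in> hull_vertices"
    then show "v \<in> middle_vertices p \<union> middle_vertices p'"
      by (cases rule: hull_vertex_cases) (use assms(2,3) in auto)
  qed
  then have "card hull_vertices \<le> card (middle_vertices p \<union> middle_vertices p')"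
    using finite_middle_vertices by (intro card_mono) auto
  also have "\<dots> \<le> card (middle_vertices p) + card (middle_vertices p')"
    by (rule card_Un_le)
  finally have "2 \<le> card (middle_vertices p) \<or> 2 \<le> card (middle_vertices p')"
    using assms(1) by linarith
  moreover have "{q. parallel_free q} = {p', p}"
    using assms(3) by auto
  ultimately show ?thesis
    using exceptional_if_two_parallel_free assms(2,3) by metis
qed

lemma noncollinear_crossings:
  assumes "3 \<le> card hull_vertices"
  shows "3 \<le> card {q. parallel_free q} + card simple_vertices \<or>
    (\<exists>p p'. p \<noteq> p' \<and> {q. parallel_free q} = {p, p'} \<and> exceptional p \<and> exceptional p')"
  using finite_parallel_free
proof (cases rule: card_less_3_cases)
  case 1
  then have "hull_vertices \<subseteq> simple_vertices"
    using hull_vertex_cases by blast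
  then show ?thesis
    using assms card_mono[OF finite_simple_vertices, of hull_vertices] by linarith
next
  case (2 q)
  then show ?thesis
    using two_simple_vertices[OF assms] by simp
next
  case (3 p p')
  show ?thesis
  proof (cases "simple_vertices = {}")
    case True
    then show ?thesis
      using two_exceptional[OF assms] 3 by blast
  next
    case False
    then have "0 < card simple_vertices"
      using finite_simple_vertices by (simp add: card_gt_0_iff)
    then show ?thesis
      using 3 by simp
  qed
qed simp

lemma three_le_or_exceptional:
  "3 \<le> card {q. parallel_free q} + card simple_vertices \<or>
   (\<exists>p p'. p \<noteq> p' \<and> {q. parallel_free q} = {p, p'} \<and> exceptional p \<and> exceptional p')"
  using finite_hull_vertices
proof (cases rule: card_less_3_cases)
  case 1
  then show ?thesis
    using concurrent_crossings[of 0] by simp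
next
  case (2 v)
  then show ?thesis
    using concurrent_crossings[of v] by simp
next
  case (3 v w)
  then show ?thesis
    using collinear_crossings by blast
next
  case 4
  then show ?thesis
    by (rule noncollinear_crossings)
qed

definition simple_vertex_pairs :: "('i \<times> 'i) set" where
  "simple_vertex_pairs = {(e, f). e \<noteq> f \<and> (\<exists>v\<in>hull_vertices. lines_at v = {e, f})}"

lemma card_simple_vertex_pairs: "card simple_vertex_pairs = 2 * card simple_vertices"
proof -
  define pairs where "pairs v = {(e, f). e \<noteq> f \<and> lines_at v = {e, f}}" for v
  have card_pairs: "card (pairs v) = 2" if v: "v \<in> simple_vertices" for v
  proof -
    obtain e f where "lines_at v = {e, f}" "e \<noteq> f"
      using v by (auto simp: simple_vertices_def card_2_iff)
    then have "pairs v = {(e, f), (f, e)}"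
      by (auto simp: pairs_def doubleton_eq_iff)
    then show ?thesis
      using \<open>e \<noteq> f\<close> by simp
  qed
  have "simple_vertex_pairs = (\<Union>v\<in>simple_vertices. pairs v)"
    by (auto simp: simple_vertex_pairs_def pairs_def simple_vertices_def)
  also have "card \<dots> = (\<Sum>v\<in>simple_vertices. card (pairs v))"
  proof (rule card_UN_disjoint[OF finite_simple_vertices])
    show "\<forall>v\<in>simple_vertices. finite (pairs v)"
      using card_pairs by (metis card.infinite zero_neq_numeral)
    have "v = w" if "pairs v \<inter> pairs w \<noteq> {}" "v \<in> simple_vertices" "w \<in> simple_vertices" for v w
      using that hull_vertices_subset inj_onD[OF inj_on_lines_at, of v w]
      by (auto simp: pairs_def simple_vertices_def)
    then show "\<forall>v\<in>simple_vertices. \<forall>w\<in>simple_vertices. v \<noteq> w \<longrightarrow> pairs v \<inter> pairs w = {}"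
      by blast
  qed
  also have "\<dots> = 2 * card simple_vertices"
    using card_pairs by simp
  finally show ?thesis .
qed

theorem six_le_parallel_free_simple_exceptional:
  "6 \<le> 2 * card {q. parallel_free q} + card simple_vertex_pairs +
     card {q. parallel_free q \<and> exceptional q}"
  using three_le_or_exceptional
proof
  assume "3 \<le> card {q. parallel_free q} + card simple_vertices"
  then show ?thesis
    using card_simple_vertex_pairs by linarith
next
  assume "\<exists>p p'. p \<noteq> p' \<and> {q. parallel_free q} = {p, p'} \<and> exceptional p \<and> exceptional p'"
  then obtain p p' where p: "p \<noteq> p'" "{q. parallel_free q} = {p, p'}"
      "exceptional p" "exceptional p'"
    by blast
  then have "{q. parallel_free q \<and> exceptional q} = {p, p'}"
    by auto
  then show ?thesis
    using p by simp
qed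

subsection \<open>Offsets along a line\<close>

text \<open>Line \<open>j\<close> meets line \<open>i\<close> at \<open>v - offset i v j *\<^sub>R perp (normal i)\<close>, and \<open>slope i j\<close> is the
  cotangent of the angle between the two lines. For parallel lines both divisions are by 0, so both
  values are 0.\<close>

definition offset :: "'i \<Rightarrow> real \<times> real \<Rightarrow> 'i \<Rightarrow> real" where
  "offset i v j = form j v / cross (normal i) (normal j)"

definition slope :: "'i \<Rightarrow> 'i \<Rightarrow> real" where
  "slope i j = (normal i \<bullet> normal j) / cross (normal i) (normal j)"

lemma crossing_at_offset:
  assumes "i \<in> lines_at v" "j \<in> A" "\<not> parallel i j"
  shows "v + (- offset i v j) *\<^sub>R perp (normal i) \<in> crossings"
proof -
  let ?x = "v + (- offset i v j) *\<^sub>R perp (normal i)"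
  have "i \<noteq> j" "cross (normal i) (normal j) \<noteq> 0"
    using assms(3) by (auto simp: parallel_def)
  moreover from this have "form i ?x = 0" "form j ?x = 0"
    using assms(1) by (simp_all only: form_add inner_perp lines_at_iff offset_def) simp_all
  ultimately show ?thesis
    unfolding crossings_def using assms(1,2) by (auto simp: lines_at_iff)
qed

lemma offset_one_sided:
  assumes v: "v \<in> hull_vertices" "i \<in> lines_at v"
  shows "(\<forall>j\<in>A. 0 \<le> offset i v j) \<or> (\<forall>j\<in>A. offset i v j \<le> 0)"
proof (rule ccontr)
  assume "\<not> ?thesis"
  then obtain j k where jk: "j \<in> A" "k \<in> A" "offset i v j < 0" "0 < offset i v k"
    by (auto simp: not_le)
  then have "\<not> parallel i j" "\<not> parallel i k"
    by (auto simp: offset_def parallel_def)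
  then have "perp (normal i) = 0"
    using hull_vertex_not_between[OF v(1) crossing_at_offset crossing_at_offset, of i k j] v(2) jk
    by simp
  then show False
    using v(2) normal_nonzero by (simp add: lines_at_iff)
qed

lemma slope_eq_if_parallel:
  assumes "parallel j k" "\<not> parallel i j" "\<not> parallel i k"
  shows "slope i j = slope i k"
  using assms inner_cross_diff[of "normal i" "normal j" "normal k"]
  by (simp add: slope_def parallel_def frac_eq_eq)

lemma line_point_eq:
  assumes "i \<in> lines_at v" "i \<in> lines_at w"
  obtains t where "w = v + t *\<^sub>R perp (normal i)"
proof -
  have n: "normal i \<noteq> 0" "normal i \<bullet> (w - v) = 0"
    using assms normal_nonzero by (simp_all add: lines_at_iff form_def inner_diff_right)
  then have "cross (perp (normal i)) (w - v) = 0"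
    by (intro cross_eq_0_if_orthogonal[of "normal i"]) (simp_all add: inner_perp)
  then obtain t where "w - v = t *\<^sub>R perp (normal i)"
    using cross_eq_0_iff[of "perp (normal i)" "w - v"] n(1) by auto
  then show ?thesis
    using that[of t] by (simp add: algebra_simps)
qed

lemma offset_add:
  assumes "\<not> parallel i j"
  shows "offset i (v + t *\<^sub>R perp (normal i)) j = offset i v j + t"
  using assms by (simp add: offset_def parallel_def form_add inner_perp add_divide_distrib)

lemma offset_eq_minus_iff:
  assumes "j \<in> A" "\<not> parallel i j"
  shows "offset i v j = - t \<longleftrightarrow> j \<in> lines_at (v + t *\<^sub>R perp (normal i))"
  using assms offset_add[OF assms(2), of v t]
  by (auto simp: offset_def parallel_def lines_at_iff)

lemma offset_in_segment:
  assumes w: "w = v + t *\<^sub>R perp (normal q)" "v \<in> hull_vertices" "w \<in> hull_vertices" "v \<noteq> w"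
    and q: "q \<in> lines_at v" "q \<in> lines_at w"
    and l: "l \<in> lines_at v" "l' \<in> lines_at w" "\<not> parallel q l" "\<not> parallel q l'"
    and j: "j \<in> A" "\<not> parallel q j"
  shows "offset q v j \<in> closed_segment 0 (- t)"
proof -
  have A: "l \<in> A" "l' \<in> A"
    using l(1,2) by (simp_all add: lines_at_iff)
  have "t \<noteq> 0"
    using w(1,4) by auto
  moreover have "offset q w k = offset q v k + t" if "\<not> parallel q k" for k
    using offset_add[OF that] w(1) by simp
  moreover have "offset q v l = 0" "offset q v l' = - t"
    using offset_eq_minus_iff[of l q v 0] offset_eq_minus_iff[of l' q v t] w(1) l A by simp_all
  moreover have "(\<forall>j\<in>A. 0 \<le> offset q v j) \<or> (\<forall>j\<in>A. offset q v j \<le> 0)"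
    "(\<forall>j\<in>A. 0 \<le> offset q w j) \<or> (\<forall>j\<in>A. offset q w j \<le> 0)"
    using offset_one_sided w q by auto
  ultimately have "(0 \<le> offset q v j \<and> offset q v j \<le> - t) \<or>
      (- t \<le> offset q v j \<and> offset q v j \<le> 0)"
    using j A l(3,4) by (smt (verit))
  then show ?thesis
    by (auto simp: closed_segment_eq_real_ivl)
qed

lemma extremal_offset:
  assumes vw: "v \<in> hull_vertices" "w \<in> hull_vertices" "v \<noteq> w"
    and lines: "lines_at v = {q, l, r}" "lines_at w = {q, l', r'}" "distinct [q, l, r, l', r']"
    and free: "parallel_free q"
  shows "extremal (A - {q}) (offset q v) = {l, r, l', r'}" "offset q v l = offset q v r"
    "offset q v l' = offset q v r'"
proof -
  have A: "{q, l, r, l', r'} \<subseteq> A"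
    using lines by (auto simp: lines_at_def)
  have not_parallel: "\<not> parallel q j" if "j \<in> A - {q}" for j
    using free that by (auto simp: parallel_free_def)
  obtain t where t: "w = v + t *\<^sub>R perp (normal q)"
    using line_point_eq[of q v w] lines by blast
  have zero: "offset q v j = 0 \<longleftrightarrow> j \<in> {l, r}" if "j \<in> A - {q}" for j
    using offset_eq_minus_iff[of j q v 0] that not_parallel lines(1) by simp
  have minus_t: "offset q v j = - t \<longleftrightarrow> j \<in> {l', r'}" if "j \<in> A - {q}" for j
    using offset_eq_minus_iff[of j q v t] that not_parallel lines(2) t by simp
  have ends: "offset q v l = 0" "offset q v r = 0" "offset q v l' = - t" "offset q v r' = - t"
    using zero minus_t A lines(3) by auto
  then show "offset q v l = offset q v r" "offset q v l' = offset q v r'"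
    by simp_all
  have "offset q v ` (A - {q}) \<subseteq> closed_segment 0 (- t)"
    using offset_in_segment[OF t vw, of l l'] not_parallel lines A by (intro image_subsetI) auto
  moreover have "0 \<in> offset q v ` (A - {q})" "- t \<in> offset q v ` (A - {q})"
    using ends A lines(3) imageI[of l "A - {q}" "offset q v"] imageI[of l' "A - {q}" "offset q v"]
    by auto
  ultimately have "extremal (A - {q}) (offset q v) =
      {j \<in> A - {q}. offset q v j = 0 \<or> offset q v j = - t}"
    by (rule extremal_eq_endpoints)
  also have "\<dots> = {l, r, l', r'}"
    using zero minus_t A lines(3) by auto
  finally show "extremal (A - {q}) (offset q v) = {l, r, l', r'}" .
qed

lemma exceptional_crossed:
  assumes "parallel_free q" "exceptional q"
  obtains v where "q \<in> lines_at v" "crossed (A - {q}) (offset q v) (slope q)"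
proof -
  obtain v w l r l' r' where vw: "v \<in> hull_vertices" "w \<in> hull_vertices" "v \<noteq> w"
    and dist: "distinct [q, l, r, l', r']"
    and lines: "lines_at v = {q, l, r}" "lines_at w = {q, l', r'}"
    and parallel: "parallel l l'" "parallel r r'"
    using assms(2) unfolding exceptional_def by blast
  have "{l, r, l', r'} \<subseteq> A"
    using lines by (auto simp: lines_at_def)
  then have "slope q l = slope q l'" "slope q r = slope q r'"
    using slope_eq_if_parallel parallel assms(1) dist by (auto simp: parallel_free_def)
  then have "crossed (A - {q}) (offset q v) (slope q)"
    unfolding crossed_def using extremal_offset[OF vw lines dist assms(1)] dist
    by (intro exI[of _ l] exI[of _ r] exI[of _ l'] exI[of _ r']) simp
  then show ?thesis
    using that lines(1) by blast
qed

end

section \<open>Counting in an abstract system of conics\<close>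

text \<open>\<open>W\<close> stands for the space of quadratic functions; only its values on \<open>S\<close> matter.\<close>

locale conic_system =
  fixes S :: "'a set" and W :: "('a \<Rightarrow> real) set"
  assumes finite_S: "finite S" and card_S: "7 \<le> card S"
    and combination_in: "G \<in> W \<Longrightarrow> H \<in> W \<Longrightarrow> (\<lambda>x. s * G x + t * H x) \<in> W"
    and interpolate: "\<lbrakk>D \<subseteq> S; card D = 4; g \<in> S - D\<rbrakk> \<Longrightarrow> \<exists>H\<in>W. (\<forall>x\<in>D. H x = 0) \<and> H g = 1"
    and through_five: "\<lbrakk>D \<subseteq> S; card D = 5\<rbrakk> \<Longrightarrow> \<exists>G\<in>W. (\<forall>x\<in>D. G x = 0) \<and> (\<exists>x\<in>S. G x \<noteq> 0)"
    and proportional: "\<lbrakk>D \<subseteq> S; card D = 5; G \<in> W; H \<in> W; \<And>z. z \<in> D \<Longrightarrow> G z = 0;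
       \<And>z. z \<in> D \<Longrightarrow> H z = 0; x \<in> S; y \<in> S\<rbrakk> \<Longrightarrow> G x * H y = G y * H x"
begin

definition cuts_out :: "('a \<Rightarrow> real) \<Rightarrow> 'a set \<Rightarrow> bool" where
  "cuts_out G \<Gamma> \<longleftrightarrow> G \<in> W \<and> (\<forall>x\<in>S. G x = 0 \<longleftrightarrow> x \<in> \<Gamma>)"

definition isolates :: "('a \<Rightarrow> real) \<Rightarrow> 'a set \<Rightarrow> 'a \<Rightarrow> bool" where
  "isolates H \<Gamma> g \<longleftrightarrow> H \<in> W \<and> (\<forall>x\<in>\<Gamma> - {g}. H x = 0) \<and> H g \<noteq> 0"

definition ordinary :: "'a set set" where
  "ordinary = {\<Gamma>. \<Gamma> \<subseteq> S \<and> card \<Gamma> = 5 \<and> (\<exists>G. cuts_out G \<Gamma>)}"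

text \<open>The choices made here change \<open>coord\<close> only by an affine map, see \<open>coord_affine\<close>.\<close>

definition equation :: "'a set \<Rightarrow> 'a \<Rightarrow> real" where
  "equation \<Gamma> = (SOME G. cuts_out G \<Gamma>)"

definition pencil_form :: "'a set \<Rightarrow> 'a \<Rightarrow> 'a \<Rightarrow> real" where
  "pencil_form \<Gamma> g = (SOME H. isolates H \<Gamma> g)"

definition coord :: "'a set \<Rightarrow> 'a \<Rightarrow> 'a \<Rightarrow> real" where
  "coord \<Gamma> g x = pencil_form \<Gamma> g x / equation \<Gamma> x"

lemma finite_subset_S: "D \<subseteq> S \<Longrightarrow> finite D"
  using finite_S finite_subset by blast

lemma finite_ordinary: "finite ordinary"
  by (rule finite_subset[of _ "Pow S"]) (auto simp: ordinary_def finite_S)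

lemma ordinaryD:
  assumes "\<Gamma> \<in> ordinary"
  shows "\<Gamma> \<subseteq> S" "card \<Gamma> = 5" "finite \<Gamma>"
  using assms finite_subset_S by (auto simp: ordinary_def)

lemma complement_nonempty:
  assumes "D \<subseteq> S" "card D < 7"
  obtains z where "z \<in> S - D"
proof -
  have "\<not> S \<subseteq> D"
    using assms card_S by force
  then show ?thesis
    using that by blast
qed

lemma cuts_out_equation: "\<Gamma> \<in> ordinary \<Longrightarrow> cuts_out (equation \<Gamma>) \<Gamma>"
  unfolding equation_def ordinary_def by (auto intro: someI_ex[of "\<lambda>G. cuts_out G \<Gamma>"])

lemma isolates_pencil_form:
  assumes "\<Gamma> \<in> ordinary" "g \<in> \<Gamma>"
  shows "isolates (pencil_form \<Gamma> g) \<Gamma> g"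
proof -
  have "\<Gamma> - {g} \<subseteq> S" "card (\<Gamma> - {g}) = 4" "g \<in> S - (\<Gamma> - {g})"
    using assms ordinaryD[OF assms(1)] by auto
  from interpolate[OF this] obtain H where "H \<in> W" "\<forall>x\<in>\<Gamma> - {g}. H x = 0" "H g = 1"
    by blast
  then have "\<exists>H. isolates H \<Gamma> g"
    by (intro exI[of _ H]) (simp add: isolates_def)
  then show ?thesis
    unfolding pencil_form_def by (rule someI_ex)
qed

lemma cuts_out_nonzero:
  assumes "\<Gamma> \<in> ordinary" "cuts_out G \<Gamma>"
  obtains z where "z \<in> S" "G z \<noteq> 0"
proof -
  obtain z where "z \<in> S - \<Gamma>"
    using complement_nonempty[of \<Gamma>] ordinaryD[OF assms(1)] by auto
  then show ?thesis
    using that assms(2) by (auto simp: cuts_out_def)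
qed

lemma multiple_of_cuts_out:
  assumes \<Gamma>: "\<Gamma> \<in> ordinary" and E: "cuts_out E \<Gamma>"
    and G: "G \<in> W" "\<And>x. x \<in> \<Gamma> \<Longrightarrow> G x = 0"
  obtains m where "\<And>x. x \<in> S \<Longrightarrow> G x = m * E x"
proof -
  note \<Gamma>D = ordinaryD[OF \<Gamma>]
  obtain z where z: "z \<in> S" "E z \<noteq> 0"
    using cuts_out_nonzero[OF \<Gamma> E] .
  have "E \<in> W" "\<And>x. x \<in> \<Gamma> \<Longrightarrow> E x = 0"
    using E \<Gamma>D(1) by (auto simp: cuts_out_def)
  then have "G x * E z = G z * E x" if "x \<in> S" for x
    using proportional[OF \<Gamma>D(1,2) G(1) _ G(2) _ that z(1)] by blast
  then have "G x = G z / E z * E x" if "x \<in> S" for x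
    using z(2) that by (simp add: field_simps)
  then show ?thesis
    using that by blast
qed

lemma coord_affine:
  assumes \<Gamma>: "\<Gamma> \<in> ordinary" "g \<in> \<Gamma>" and G: "cuts_out G \<Gamma>" and H: "isolates H \<Gamma> g"
  obtains c c' where "c \<noteq> 0" "\<And>x. x \<in> S - \<Gamma> \<Longrightarrow> coord \<Gamma> g x = c * (H x / G x) + c'"
proof -
  let ?E = "equation \<Gamma>" and ?P = "pencil_form \<Gamma> g"
  have E: "?E \<in> W" "\<And>x. x \<in> \<Gamma> \<Longrightarrow> ?E x = 0"
    using cuts_out_equation[OF \<Gamma>(1)] ordinaryD(1)[OF \<Gamma>(1)] by (auto simp: cuts_out_def)
  have P: "isolates ?P \<Gamma> g"
    by (rule isolates_pencil_form[OF \<Gamma>])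
  obtain m where m: "\<And>x. x \<in> S \<Longrightarrow> ?E x = m * G x"
    using multiple_of_cuts_out[OF \<Gamma>(1) G E] by blast
  obtain z where "z \<in> S" "?E z \<noteq> 0"
    using cuts_out_nonzero[OF \<Gamma>(1) cuts_out_equation[OF \<Gamma>(1)]] .
  then have "m \<noteq> 0"
    using m by auto
  have "(\<lambda>x. H g * ?P x + (- ?P g) * H x) \<in> W"
    using H P by (intro combination_in) (simp_all add: isolates_def)
  moreover have "H g * ?P x + (- ?P g) * H x = 0" if "x \<in> \<Gamma>" for x
    using that H P by (cases "x = g") (simp_all add: isolates_def)
  ultimately obtain k where k: "\<And>x. x \<in> S \<Longrightarrow> H g * ?P x + (- ?P g) * H x = k * G x"
    using multiple_of_cuts_out[OF \<Gamma>(1) G] by blast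
  have nonzero: "H g \<noteq> 0" "?P g \<noteq> 0"
    using H P by (simp_all add: isolates_def)
  show thesis
  proof (rule that[of "?P g / (H g * m)" "k / (H g * m)"])
    show "?P g / (H g * m) \<noteq> 0"
      using nonzero \<open>m \<noteq> 0\<close> by simp
    fix x assume x: "x \<in> S - \<Gamma>"
    then have "G x \<noteq> 0"
      using G by (auto simp: cuts_out_def)
    moreover have "H g * ?P x = ?P g * H x + k * G x"
      using k[of x] x by simp
    ultimately show "coord \<Gamma> g x = ?P g / (H g * m) * (H x / G x) + k / (H g * m)"
      using x m[of x] nonzero \<open>m \<noteq> 0\<close> by (simp add: coord_def field_simps)
  qed
qed

text \<open>Two points with equal coordinates \<open>e\<close> and \<open>f\<close> would lie, together with the other three
  points of \<open>\<Gamma>\<close>, on two different conics.\<close>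

lemma coord_inj:
  assumes \<Gamma>: "\<Gamma> \<in> ordinary" "e \<in> \<Gamma>" "f \<in> \<Gamma>" "e \<noteq> f" and x: "x \<in> S - \<Gamma>" "y \<in> S - \<Gamma>"
    and eq: "coord \<Gamma> e x = coord \<Gamma> e y" "coord \<Gamma> f x = coord \<Gamma> f y"
  shows "x = y"
proof (rule ccontr)
  assume "x \<noteq> y"
  note \<Gamma>D = ordinaryD[OF \<Gamma>(1)]
  have E: "equation \<Gamma> \<in> W" "\<And>z. z \<in> \<Gamma> \<Longrightarrow> equation \<Gamma> z = 0"
      "equation \<Gamma> x \<noteq> 0" "equation \<Gamma> y \<noteq> 0"
    using cuts_out_equation[OF \<Gamma>(1)] \<Gamma>D(1) x by (auto simp: cuts_out_def)
  define P where "P g = (\<lambda>z. coord \<Gamma> g x * equation \<Gamma> z + (- 1) * pencil_form \<Gamma> g z)" for g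
  define D where "D = insert x (insert y (\<Gamma> - {e, f}))"
  have D: "D \<subseteq> S" "card D = 5"
    using \<Gamma> \<Gamma>D x \<open>x \<noteq> y\<close> by (auto simp: D_def card_Diff_subset)
  have P: "P g \<in> W" "\<And>z. z \<in> \<Gamma> - {g} \<Longrightarrow> P g z = 0" "P g g \<noteq> 0" if "g \<in> \<Gamma>" for g
  proof -
    have "isolates (pencil_form \<Gamma> g) \<Gamma> g"
      by (rule isolates_pencil_form[OF \<Gamma>(1) that])
    then have "pencil_form \<Gamma> g \<in> W" "\<And>z. z \<in> \<Gamma> - {g} \<Longrightarrow> pencil_form \<Gamma> g z = 0"
        "pencil_form \<Gamma> g g \<noteq> 0"
      by (simp_all add: isolates_def)
    then show "P g \<in> W" "\<And>z. z \<in> \<Gamma> - {g} \<Longrightarrow> P g z = 0" "P g g \<noteq> 0"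
      unfolding P_def using E(1,2) that by (simp_all only: combination_in) simp_all
  qed
  have "P g x = 0" "coord \<Gamma> g x = coord \<Gamma> g y \<Longrightarrow> P g y = 0" for g
    using E(3,4) by (simp_all add: P_def coord_def)
  then have zero: "P e z = 0" "P f z = 0" if "z \<in> D" for z
    using that P \<Gamma> eq by (auto simp: D_def)
  have "P e e * P f f = P e f * P f e"
    using proportional[OF D P(1)[OF \<Gamma>(2)] P(1)[OF \<Gamma>(3)] zero] \<Gamma> \<Gamma>D by blast
  then show False
    using P(2)[of f e] P(3) \<Gamma> by simp
qed

definition extremal_points :: "'a set \<Rightarrow> 'a \<Rightarrow> 'a set" where
  "extremal_points \<Gamma> g = extremal (S - \<Gamma>) (coord \<Gamma> g)"

definition crossed_coords :: "'a set \<Rightarrow> 'a \<Rightarrow> 'a \<Rightarrow> bool" where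
  "crossed_coords \<Gamma> d q \<longleftrightarrow> crossed (S - \<Gamma>) (coord \<Gamma> d) (coord \<Gamma> q)"

definition extensions :: "'a set \<Rightarrow> 'a set" where
  "extensions D = {q \<in> S - D. insert q D \<in> ordinary}"

definition corners :: "'a set \<Rightarrow> 'a \<Rightarrow> ('a \<times> 'a) set" where
  "corners D d = {(e, f). e \<in> S - D \<and> f \<in> S - D \<and> e \<noteq> f \<and>
     (let \<Gamma> = insert e (insert f (D - {d})) in
       \<Gamma> \<in> ordinary \<and> d \<in> extremal_points \<Gamma> e \<inter> extremal_points \<Gamma> f)}"

definition crossed_extensions :: "'a set \<Rightarrow> 'a \<Rightarrow> 'a set" where
  "crossed_extensions D d = {q \<in> extensions D. crossed_coords (insert q D) d q}"

lemma finite_extensions: "finite (extensions D)"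
  using finite_S by (simp add: extensions_def)

lemma finite_crossed_extensions: "finite (crossed_extensions D d)"
  using finite_extensions by (simp add: crossed_extensions_def)

lemma finite_corners: "finite (corners D d)"
  by (rule finite_subset[of _ "S \<times> S"]) (auto simp: corners_def finite_S)

end

subsection \<open>The conics through three points\<close>

text \<open>The conics through \<open>D - {d}\<close> with value 1 at \<open>d\<close> form the affine plane of the functions
  \<open>\<lambda>x. N x \<bullet> v + Q x\<close>; the point \<open>x\<close> becomes the line of all \<open>v\<close> with \<open>N x \<bullet> v + Q x = 0\<close>.\<close>

locale conic_net = conic_system S W
  for S :: "'a set" and W :: "('a \<Rightarrow> real) set" +
  fixes D :: "'a set" and d :: 'a and N :: "'a \<Rightarrow> real \<times> real" and Q :: "'a \<Rightarrow> real"
  assumes D: "D \<subseteq> S" "card D = 4" and d: "d \<in> D"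
    and pencil_in: "(\<lambda>x. N x \<bullet> u) \<in> W" and Q_in: "Q \<in> W"
    and N_eq_0_iff: "x \<in> S \<Longrightarrow> N x = 0 \<longleftrightarrow> x \<in> D"
    and independent: "\<exists>i\<in>S - D. \<exists>j\<in>S - D. cross (N i) (N j) \<noteq> 0"
    and Q_eq_0: "x \<in> D - {d} \<Longrightarrow> Q x = 0" and Q_d: "Q d = 1"
begin

lemma finite_D: "finite D"
  using D(1) by (rule finite_subset_S)

lemma N_eq_0: "x \<in> D \<Longrightarrow> N x = 0"
  using D N_eq_0_iff by blast

lemma net_in: "(\<lambda>x. N x \<bullet> v + Q x) \<in> W"
  using combination_in[OF pencil_in Q_in, of 1 v 1] by simp

lemma parallel_lines_disjoint:
  assumes ij: "i \<in> S - D" "j \<in> S - D" "i \<noteq> j" "cross (N i) (N j) = 0" and i: "N i \<bullet> v + Q i = 0"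
  shows "N j \<bullet> v + Q j \<noteq> 0"
proof
  assume j: "N j \<bullet> v + Q j = 0"
  let ?K = "\<lambda>x. N x \<bullet> perp (N i)" and ?L = "\<lambda>x. N x \<bullet> v + Q x"
  let ?\<Gamma> = "insert i (insert j (D - {d}))"
  have \<Gamma>: "?\<Gamma> \<subseteq> S" "card ?\<Gamma> = 5"
    using ij D d finite_D by auto
  have zero: "?K x = 0" "?L x = 0" if "x \<in> ?\<Gamma>" for x
    using that i j ij(4) N_eq_0 Q_eq_0 by (auto simp: inner_perp)
  have "?K y * ?L d = ?K d * ?L y" if "y \<in> S" for y
    using proportional[OF \<Gamma> pencil_in net_in zero] d D that by blast
  then have "cross (N i) (N y) = 0" if "y \<in> S" for y
    using that N_eq_0[OF d] Q_d by (simp add: inner_perp)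
  then have "cross (N y) (N z) = 0" if "y \<in> S" "z \<in> S" for y z
    using cross_eq_0_trans[of "N i" "N y" "N z"] that ij(1) N_eq_0_iff
    by (simp add: cross_eq_0_commute[of "N y"])
  then show False
    using independent by blast
qed

sublocale line_arrangement "S - D" N Q
proof
  show "finite (S - D)"
    using finite_S by simp
  show "3 \<le> card (S - D)"
    using card_S D finite_D by (simp add: card_Diff_subset)
  show "N i \<noteq> 0" if "i \<in> S - D" for i
    using that N_eq_0_iff by blast
  show "\<exists>i\<in>S - D. \<exists>j\<in>S - D. cross (N i) (N j) \<noteq> 0"
    by (rule independent)
qed (rule parallel_lines_disjoint)

lemma form_in: "(\<lambda>x. form x v) \<in> W"
  unfolding form_def by (rule net_in)

lemma cross_in: "(\<lambda>x. cross u (N x)) \<in> W"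
  using pencil_in[of "perp u"] by (simp add: inner_perp)

lemma form_eq_0: "x \<in> D - {d} \<Longrightarrow> form x v = 0"
  by (simp add: form_def N_eq_0 Q_eq_0)

lemma form_d: "form d v = 1"
  using d by (simp add: form_def N_eq_0 Q_d)

lemma parallel_free_cuts_out:
  assumes "parallel_free q"
  shows "cuts_out (\<lambda>x. cross (N q) (N x)) (insert q D)"
  using assms cross_in N_eq_0 by (auto simp: cuts_out_def parallel_free_def parallel_def)

lemma parallel_free_ordinary:
  assumes "parallel_free q"
  shows "insert q D \<in> ordinary"
  unfolding ordinary_def using parallel_free_cuts_out[OF assms] assms D finite_D
  by (auto simp: parallel_free_def)

lemma vertex_cuts_out:
  assumes "lines_at v = {e, f}"
  shows "cuts_out (\<lambda>x. form x v) (insert e (insert f (D - {d})))"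
proof -
  have "form x v = 0 \<longleftrightarrow> x \<in> insert e (insert f (D - {d}))" if "x \<in> S" for x
  proof (cases "x \<in> D")
    case True
    moreover have "x \<notin> {e, f}"
      using True assms by (auto simp: lines_at_def)
    ultimately show ?thesis
      using form_eq_0 form_d by (cases "x = d") auto
  next
    case False
    then have "form x v = 0 \<longleftrightarrow> x \<in> {e, f}"
      using that assms lines_at_iff[of x v] by simp
    with False show ?thesis
      by auto
  qed
  then show ?thesis
    using form_in by (simp add: cuts_out_def)
qed

lemma vertex_ordinary:
  assumes "lines_at v = {e, f}" "e \<noteq> f"
  shows "insert e (insert f (D - {d})) \<in> ordinary"
proof -
  have "{e, f} \<subseteq> S - D"
    using assms(1) by (auto simp: lines_at_def)
  then show ?thesis
    unfolding ordinary_def using vertex_cuts_out[OF assms(1)] assms(2) D d finite_D by auto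
qed

lemma vertex_extremal:
  assumes v: "v \<in> hull_vertices" and lines: "lines_at v = {e, f}" "e \<noteq> f"
  defines "\<Gamma> \<equiv> insert e (insert f (D - {d}))"
  shows "d \<in> extremal_points \<Gamma> e"
proof -
  define ratio where "ratio x = cross (N f) (N x) / form x v" for x
  have at: "e \<in> lines_at v" "f \<in> lines_at v"
    using lines(1) by auto
  then have "isolates (\<lambda>x. cross (N f) (N x)) \<Gamma> e"
    using not_parallel_at[OF at(2,1)] lines(2) cross_in N_eq_0
    by (auto simp: isolates_def \<Gamma>_def parallel_def)
  then obtain c c' where c: "c \<noteq> 0" "\<And>x. x \<in> S - \<Gamma> \<Longrightarrow> coord \<Gamma> e x = c * ratio x + c'"
    using coord_affine[OF vertex_ordinary[OF lines] _ vertex_cuts_out[OF lines(1)], of e]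
    unfolding ratio_def \<Gamma>_def by blast
  have "ratio d = 0"
    using N_eq_0[OF d] by (simp add: ratio_def)
  moreover have "d \<in> S - \<Gamma>"
    using d D at by (auto simp: \<Gamma>_def lines_at_def)
  moreover have "(\<forall>x\<in>S - \<Gamma>. 0 \<le> ratio x) \<or> (\<forall>x\<in>S - \<Gamma>. ratio x \<le> 0)"
  proof -
    have "ratio x = inverse (offset f v x)" for x
      by (simp add: ratio_def offset_def)
    then have "(\<forall>x\<in>S - D. 0 \<le> ratio x) \<or> (\<forall>x\<in>S - D. ratio x \<le> 0)"
      using offset_one_sided[OF v at(2)] by simp
    moreover have "S - \<Gamma> \<subseteq> insert d (S - D)"
      by (auto simp: \<Gamma>_def)
    ultimately show ?thesis
      using \<open>ratio d = 0\<close> by (metis insertE order_refl subsetD)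
  qed
  ultimately have "d \<in> extremal (S - \<Gamma>) ratio"
    by (auto simp: extremal_def)
  then show ?thesis
    using extremal_affine[of "S - \<Gamma>" "coord \<Gamma> e" c ratio c'] c by (simp add: extremal_points_def)
qed

lemma simple_vertex_pairs_subset: "simple_vertex_pairs \<subseteq> corners D d"
proof (rule subrelI)
  fix e f assume "(e, f) \<in> simple_vertex_pairs"
  then obtain v where v: "v \<in> hull_vertices" and ef: "lines_at v = {e, f}" "e \<noteq> f"
    by (auto simp: simple_vertex_pairs_def)
  then have fe: "lines_at v = {f, e}" "f \<noteq> e"
    by auto
  have "e \<in> S - D" "f \<in> S - D"
    using ef(1) by (auto simp: lines_at_def)
  then show "(e, f) \<in> corners D d"
    using vertex_ordinary[OF ef] vertex_extremal[OF v ef] vertex_extremal[OF v fe] ef(2)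
    by (simp add: corners_def Let_def insert_commute)
qed

lemma exceptional_crossed_coords:
  assumes q: "parallel_free q" "exceptional q"
  shows "crossed_coords (insert q D) d q"
proof -
  let ?\<Gamma> = "insert q D"
  have q_in: "q \<in> S - D"
    using q(1) by (simp add: parallel_free_def)
  obtain v where v: "q \<in> lines_at v" "crossed (S - D - {q}) (offset q v) (slope q)"
    using exceptional_crossed[OF q] .
  note affine = coord_affine[OF parallel_free_ordinary[OF q(1)] _ parallel_free_cuts_out[OF q(1)]]
  have "isolates (\<lambda>x. form x v) ?\<Gamma> d"
    using form_in[of v] form_eq_0[of _ v] form_d[of v] v(1)
    by (auto simp: isolates_def lines_at_iff)
  then obtain c c' where c: "c \<noteq> 0" "\<And>x. x \<in> S - ?\<Gamma> \<Longrightarrow> coord ?\<Gamma> d x = c * offset q v x + c'"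
    using affine[of d] d unfolding offset_def by blast
  have "isolates (\<lambda>x. N q \<bullet> N x) ?\<Gamma> q"
    using pencil_in[of "N q"] N_eq_0 N_eq_0_iff q_in by (auto simp: isolates_def inner_commute)
  then obtain k k' where k: "k \<noteq> 0" "\<And>x. x \<in> S - ?\<Gamma> \<Longrightarrow> coord ?\<Gamma> q x = k * slope q x + k'"
    using affine[of q] unfolding slope_def by blast
  have "S - ?\<Gamma> = S - D - {q}"
    by blast
  with v(2) show ?thesis
    unfolding crossed_coords_def
    using crossed_affine[of "S - ?\<Gamma>" "offset q v" "slope q"] c k by simp
qed

lemma six_le_card_extensions_corners:
  "6 \<le> 2 * card (extensions D) + card (corners D d) + card (crossed_extensions D d)"
proof -
  have free: "{q. parallel_free q} \<subseteq> extensions D"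
    using parallel_free_ordinary by (auto simp: extensions_def parallel_free_def)
  then have "{q. parallel_free q \<and> exceptional q} \<subseteq> crossed_extensions D d"
    using exceptional_crossed_coords by (auto simp: crossed_extensions_def)
  then have "card {q. parallel_free q} \<le> card (extensions D)"
    "card simple_vertex_pairs \<le> card (corners D d)"
    "card {q. parallel_free q \<and> exceptional q} \<le> card (crossed_extensions D d)"
    using free simple_vertex_pairs_subset finite_extensions finite_corners finite_crossed_extensions
    by (simp_all add: card_mono)
  then show ?thesis
    using six_le_parallel_free_simple_exceptional by linarith
qed

end

subsection \<open>Double counting\<close>

lemma sum_card_le_if_inj_on_Sigma:
  assumes "finite A" "\<And>x. x \<in> A \<Longrightarrow> finite (B x)" "finite C" "\<And>y. y \<in> C \<Longrightarrow> finite (E y)"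
    and "inj_on g (Sigma A B)" "g ` Sigma A B \<subseteq> Sigma C E"
  shows "(\<Sum>x\<in>A. card (B x)) \<le> (\<Sum>y\<in>C. card (E y))"
proof -
  have "card (Sigma A B) \<le> card (Sigma C E)"
    using assms by (intro card_inj_on_le[of g] finite_SigmaI)
  then show ?thesis
    using assms(1-4) by simp
qed

context conic_system
begin

lemma pencil_common_zero:
  assumes D: "D \<subseteq> S" "card D = 4"
    and G: "G \<in> W" "\<And>x. x \<in> D \<Longrightarrow> G x = 0" and H: "H \<in> W" "\<And>x. x \<in> D \<Longrightarrow> H x = 0"
    and yz: "y \<in> S" "z \<in> S" "G y * H z \<noteq> G z * H y"
    and x: "x \<in> S" "G x = 0" "H x = 0"
  shows "x \<in> D"
proof (rule ccontr)
  assume "x \<notin> D"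
  then have "insert x D \<subseteq> S" "card (insert x D) = 5"
    using x(1) D finite_subset_S by auto
  then have "G y * H z = G z * H y"
    using proportional[of "insert x D" G H y z] G H x(2,3) yz(1,2) by auto
  then show False
    using yz(3) by simp
qed

lemma six_le_pointed_quadruple:
  assumes D: "D \<subseteq> S" "card D = 4" "d \<in> D"
  shows "6 \<le> 2 * card (extensions D) + card (corners D d) + card (crossed_extensions D d)"
proof -
  have "finite D"
    using D(1) by (rule finite_subset_S)
  obtain e where e: "e \<in> S - D"
    using complement_nonempty[of D] D by auto
  then have "card (insert e D) = 5" "insert e D \<subseteq> S"
    using D \<open>finite D\<close> by auto
  then obtain Q1 y where Q1: "Q1 \<in> W" "\<forall>x\<in>insert e D. Q1 x = 0" and y: "y \<in> S" "Q1 y \<noteq> 0"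
    using through_five by metis
  obtain Q2 where Q2: "Q2 \<in> W" "\<forall>x\<in>D. Q2 x = 0" "Q2 e = 1"
    using interpolate[OF D(1,2) e] by blast
  have "insert e (D - {d}) \<subseteq> S" "card (insert e (D - {d})) = 4" "d \<in> S - insert e (D - {d})"
    using e D \<open>finite D\<close> by auto
  then obtain Q0 where Q0: "Q0 \<in> W" "\<forall>x\<in>insert e (D - {d}). Q0 x = 0" "Q0 d = 1"
    using interpolate by metis
  define N where "N x = (Q1 x, Q2 x)" for x
  interpret conic_net S W D d N Q0
  proof
    show "(\<lambda>x. N x \<bullet> u) \<in> W" for u
      using combination_in[OF Q1(1) Q2(1), of "fst u" "snd u"]
      by (simp add: N_def inner_prod_def mult.commute)
    show "N x = 0 \<longleftrightarrow> x \<in> D" if "x \<in> S" for x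
      using pencil_common_zero[OF D(1,2), of Q1 Q2 y e x] that Q1 Q2 y e
      by (auto simp: N_def zero_prod_def)
    have "cross (N e) (N y) \<noteq> 0"
      using Q1 Q2 y by (simp add: N_def cross_def)
    moreover have "y \<in> S - D"
      using Q1 y by auto
    ultimately show "\<exists>i\<in>S - D. \<exists>j\<in>S - D. cross (N i) (N j) \<noteq> 0"
      using e by blast
  qed (use D Q0 in auto)
  show ?thesis
    by (rule six_le_card_extensions_corners)
qed

definition pointed_quadruples :: "('a set \<times> 'a) set" where
  "pointed_quadruples = Sigma {D. D \<subseteq> S \<and> card D = 4} (\<lambda>D. D)"

definition ordered_pairs :: "'a set \<Rightarrow> ('a \<times> 'a) set" where
  "ordered_pairs \<Gamma> = Sigma \<Gamma> (\<lambda>d. \<Gamma> - {d})"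

definition extremal_triples :: "'a set \<Rightarrow> (('a \<times> 'a) \<times> 'a) set" where
  "extremal_triples \<Gamma> =
     Sigma (ordered_pairs \<Gamma>) (\<lambda>(e, f). extremal_points \<Gamma> e \<inter> extremal_points \<Gamma> f)"

definition crossed_pairs :: "'a set \<Rightarrow> ('a \<times> 'a) set" where
  "crossed_pairs \<Gamma> = {p \<in> ordered_pairs \<Gamma>. crossed_coords \<Gamma> (fst p) (snd p)}"

lemma finite_pointed_quadruples: "finite pointed_quadruples"
  using finite_S finite_subset_S unfolding pointed_quadruples_def by (intro finite_SigmaI) auto

lemma card_pointed_quadruples: "card pointed_quadruples = 4 * (card S choose 4)"
proof -
  have "card pointed_quadruples = (\<Sum>D | D \<subseteq> S \<and> card D = 4. card D)"
    unfolding pointed_quadruples_def using finite_S finite_subset_S by (intro card_SigmaI) auto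
  also have "\<dots> = 4 * card {D. D \<subseteq> S \<and> card D = 4}"
    by simp
  finally show ?thesis
    by (simp add: n_subsets[OF finite_S])
qed

lemma finite_extremal_points: "finite (extremal_points \<Gamma> g)"
  unfolding extremal_points_def by (rule finite_subset[OF extremal_subset]) (simp add: finite_S)

lemma finite_ordered_pairs: "\<Gamma> \<in> ordinary \<Longrightarrow> finite (ordered_pairs \<Gamma>)"
  using ordinaryD(3) by (simp add: ordered_pairs_def)

lemma finite_extremal_triples: "\<Gamma> \<in> ordinary \<Longrightarrow> finite (extremal_triples \<Gamma>)"
  unfolding extremal_triples_def using finite_ordered_pairs finite_extremal_points
  by (intro finite_SigmaI) auto

lemma card_ordered_pairs: "\<Gamma> \<in> ordinary \<Longrightarrow> card (ordered_pairs \<Gamma>) = 20"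
  using ordinaryD by (simp add: ordered_pairs_def)

lemma card_extremal_triples_crossed_pairs:
  assumes "\<Gamma> \<in> ordinary"
  shows "card (extremal_triples \<Gamma>) + card (crossed_pairs \<Gamma>) \<le> 80"
proof -
  note \<Gamma> = ordinaryD[OF assms]
  let ?common = "\<lambda>e f. card (extremal_points \<Gamma> e \<inter> extremal_points \<Gamma> f)"
  have "card (extremal_triples \<Gamma>) = (\<Sum>(e, f)\<in>ordered_pairs \<Gamma>. ?common e f)"
    unfolding extremal_triples_def using finite_ordered_pairs[OF assms] finite_extremal_points
    by (simp add: case_prod_beta)
  moreover have "card (crossed_pairs \<Gamma>) =
      (\<Sum>(e, f)\<in>ordered_pairs \<Gamma>. of_bool (crossed_coords \<Gamma> e f))"
    unfolding crossed_pairs_def using finite_ordered_pairs[OF assms]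
    by (simp add: case_prod_beta Int_def)
  ultimately have "card (extremal_triples \<Gamma>) + card (crossed_pairs \<Gamma>)
      = (\<Sum>(e, f)\<in>ordered_pairs \<Gamma>. ?common e f + of_bool (crossed_coords \<Gamma> e f))"
    by (simp add: sum.distrib case_prod_beta)
  also have "\<dots> = (\<Sum>e\<in>\<Gamma>. \<Sum>f\<in>\<Gamma> - {e}. ?common e f + of_bool (crossed_coords \<Gamma> e f))"
    unfolding ordered_pairs_def using \<Gamma>(3) by (subst sum.Sigma) auto
  also have "\<dots> \<le> (\<Sum>e\<in>\<Gamma>. 16)"
  proof (rule sum_mono)
    fix e assume e: "e \<in> \<Gamma>"
    then have four: "card (\<Gamma> - {e}) = 4"
      using \<Gamma> by simp
    interpret separating_coordinates "S - \<Gamma>" "\<Gamma> - {e}" "coord \<Gamma> e" "coord \<Gamma>"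
      using finite_S \<Gamma>(3) coord_inj[OF assms] e by unfold_locales blast+
    show "(\<Sum>f\<in>\<Gamma> - {e}. ?common e f + of_bool (crossed_coords \<Gamma> e f)) \<le> 16"
      using sum_card_extremal_Int_le four by (simp add: extremal_points_def crossed_coords_def)
  qed
  also have "\<dots> = 80"
    using \<Gamma>(2) by simp
  finally show ?thesis .
qed

lemma sum_card_extensions_le:
  fixes R :: "'a set \<Rightarrow> 'a \<Rightarrow> 'a \<Rightarrow> bool"
  shows "(\<Sum>(D, d)\<in>pointed_quadruples. card {q \<in> extensions D. R (insert q D) d q})
    \<le> (\<Sum>\<Gamma>\<in>ordinary. card {p \<in> ordered_pairs \<Gamma>. R \<Gamma> (fst p) (snd p)})"
  unfolding case_prod_beta
proof (rule sum_card_le_if_inj_on_Sigma)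
  let ?g = "\<lambda>((D, d), q). (insert q D, (d, q))"
    and ?Z = "Sigma pointed_quadruples
      (\<lambda>p. {q \<in> extensions (fst p). R (insert q (fst p)) (snd p) q})"
  show "inj_on ?g ?Z"
    by (auto simp: inj_on_def extensions_def insert_ident)
  show "?g ` ?Z \<subseteq> Sigma ordinary (\<lambda>\<Gamma>. {p \<in> ordered_pairs \<Gamma>. R \<Gamma> (fst p) (snd p)})"
    by (auto simp: extensions_def pointed_quadruples_def ordered_pairs_def)
qed (simp_all add: finite_pointed_quadruples finite_extensions finite_ordinary finite_ordered_pairs)

lemma sum_card_corners_le:
  "(\<Sum>(D, d)\<in>pointed_quadruples. card (corners D d))
    \<le> (\<Sum>\<Gamma>\<in>ordinary. card (extremal_triples \<Gamma>))"
  unfolding case_prod_beta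
proof (rule sum_card_le_if_inj_on_Sigma)
  let ?g = "\<lambda>((D, d), (e, f)). (insert e (insert f (D - {d})), ((e, f), d))"
    and ?Z = "Sigma pointed_quadruples (\<lambda>p. corners (fst p) (snd p))"
  show "inj_on ?g ?Z"
    by (rule inj_on_inverseI[of _ "\<lambda>(\<Gamma>, ((e, f), d)). ((insert d (\<Gamma> - {e, f}), d), (e, f))"])
      (auto simp: pointed_quadruples_def corners_def)
  show "?g ` ?Z \<subseteq> Sigma ordinary extremal_triples"
    by (auto simp: corners_def pointed_quadruples_def ordered_pairs_def extremal_triples_def
        Let_def)
qed (simp_all add: finite_pointed_quadruples finite_corners finite_ordinary finite_extremal_triples)

theorem choose_4_le_card_ordinary: "card S choose 4 \<le> 5 * card ordinary"
proof -
  have extensions_le: "(\<Sum>(D, d)\<in>pointed_quadruples. card (extensions D))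
      \<le> (\<Sum>\<Gamma>\<in>ordinary. card (ordered_pairs \<Gamma>))"
    using sum_card_extensions_le[of "\<lambda>_ _ _. True"] by simp
  have crossed_le: "(\<Sum>(D, d)\<in>pointed_quadruples. card (crossed_extensions D d))
      \<le> (\<Sum>\<Gamma>\<in>ordinary. card (crossed_pairs \<Gamma>))"
    using sum_card_extensions_le[of crossed_coords]
    by (simp add: crossed_extensions_def crossed_pairs_def)
  have "24 * (card S choose 4) = (\<Sum>(D, d)\<in>pointed_quadruples. 6)"
    by (simp add: card_pointed_quadruples case_prod_beta)
  also have "\<dots> \<le> (\<Sum>(D, d)\<in>pointed_quadruples.
      2 * card (extensions D) + card (corners D d) + card (crossed_extensions D d))"
    using six_le_pointed_quadruple by (intro sum_mono) (auto simp: pointed_quadruples_def)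
  also have "\<dots> = 2 * (\<Sum>(D, d)\<in>pointed_quadruples. card (extensions D))
      + (\<Sum>(D, d)\<in>pointed_quadruples. card (corners D d))
      + (\<Sum>(D, d)\<in>pointed_quadruples. card (crossed_extensions D d))"
    by (simp add: case_prod_beta sum.distrib sum_distrib_left)
  also have "\<dots> \<le> 2 * (\<Sum>\<Gamma>\<in>ordinary. card (ordered_pairs \<Gamma>))
      + (\<Sum>\<Gamma>\<in>ordinary. card (extremal_triples \<Gamma>)) + (\<Sum>\<Gamma>\<in>ordinary. card (crossed_pairs \<Gamma>))"
    using extensions_le sum_card_corners_le crossed_le by linarith
  also have "\<dots> = (\<Sum>\<Gamma>\<in>ordinary. 40 + (card (extremal_triples \<Gamma>) + card (crossed_pairs \<Gamma>)))"
    by (simp add: card_ordered_pairs sum.distrib)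
  also have "\<dots> \<le> (\<Sum>\<Gamma>\<in>ordinary. 40 + 80)"
    using card_extremal_triples_crossed_pairs by (intro sum_mono add_left_mono)
  finally show ?thesis
    by simp
qed

end

section \<open>Quadratic functions on the plane\<close>

definition area :: "real \<times> real \<Rightarrow> real \<times> real \<Rightarrow> real \<times> real \<Rightarrow> real" where
  "area p q z = cross (q - p) (z - p)"

definition general_position :: "(real \<times> real) set \<Rightarrow> bool" where
  "general_position D \<longleftrightarrow> (\<forall>p\<in>D. \<forall>q\<in>D. \<forall>r\<in>D. distinct [p, q, r] \<longrightarrow> area p q r \<noteq> 0)"

definition quad :: "real \<Rightarrow> real \<Rightarrow> real \<Rightarrow> real \<Rightarrow> real \<Rightarrow> real \<Rightarrow> real \<times> real \<Rightarrow> real" where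
  "quad a b c d e f z =
     a * (fst z)\<^sup>2 + b * fst z * snd z + c * (snd z)\<^sup>2 + d * fst z + e * snd z + f"

definition quads :: "(real \<times> real \<Rightarrow> real) set" where
  "quads = {G. \<exists>a b c d e f. G = quad a b c d e f}"

lemma area_expand:
  "area p q z = (fst q - fst p) * (snd z - snd p) - (snd q - snd p) * (fst z - fst p)"
  by (simp add: area_def cross_def)

lemma area_self [simp]: "area p q p = 0" "area p q q = 0"
  by (simp_all add: area_def)

lemma area_midpoint: "area p q (midpoint x y) = (area p q x + area p q y) / 2"
  by (simp add: area_expand midpoint_def field_simps)

lemma collinear_if_area_eq_0:
  assumes "area p q z = 0"
  shows "collinear {p, z, q}"
proof (cases "p = q")
  case False
  then obtain t where "z - p = t *\<^sub>R (q - p)"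
    using assms cross_eq_0_iff[of "q - p"] by (auto simp: area_def)
  then have "z = (1 - t) *\<^sub>R p + (1 - (1 - t)) *\<^sub>R q"
    by (simp add: algebra_simps)
  then show ?thesis
    unfolding collinear_3_expand by blast
qed (simp add: collinear_3_expand)

lemma general_positionD:
  assumes "general_position D" "{p, q, r} \<subseteq> D" "distinct [p, q, r]"
  shows "area p q r \<noteq> 0"
  using assms by (simp add: general_position_def)

lemma general_position_subset: "general_position D \<Longrightarrow> E \<subseteq> D \<Longrightarrow> general_position E"
  unfolding general_position_def by blast

lemma general_position_if_no_three_collinear:
  assumes "\<forall>T\<subseteq>S. card T = 3 \<longrightarrow> \<not> collinear T"
  shows "general_position S"
  unfolding general_position_def
proof (intro ballI impI notI)
  fix p q r assume "p \<in> S" "q \<in> S" "r \<in> S" "distinct [p, q, r]" "area p q r = 0"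
  then have "{p, r, q} \<subseteq> S" "card {p, r, q} = 3" "collinear {p, r, q}"
    using collinear_if_area_eq_0 by auto
  then show False
    using assms by blast
qed

lemma area_sum: "area q r z + area r p z + area p q z = area p q r"
  by (simp add: area_expand algebra_simps)

lemma area_barycentric:
  "area p q r *\<^sub>R z = area q r z *\<^sub>R p + area r p z *\<^sub>R q + area p q z *\<^sub>R r"
  by (simp add: prod_eq_iff area_expand algebra_simps)

lemma card_4E:
  assumes "card D = 4"
  obtains p q r s where "D = {p, q, r, s}" "distinct [p, q, r, s]"
  using assms by (auto simp: numeral_eq_Suc card_Suc_eq)

lemma card_5E:
  assumes "card D = 5"
  obtains p q r s t where "D = {p, q, r, s, t}" "distinct [p, q, r, s, t]"
proof -
  obtain p E where E: "D = insert p E" "p \<notin> E" "card E = 4"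
    using assms card_Suc_eq[of D 4] by auto
  obtain q r s t where "E = {q, r, s, t}" "distinct [q, r, s, t]"
    using card_4E[OF E(3)] .
  with E that show ?thesis
    by simp
qed

lemma quad_in_quads: "quad a b c d e f \<in> quads"
  unfolding quads_def by blast

lemma quads_combination:
  assumes "G \<in> quads" "H \<in> quads"
  shows "(\<lambda>z. s * G z + t * H z) \<in> quads"
proof -
  obtain a b c d e f a' b' c' d' e' f' where "G = quad a b c d e f" "H = quad a' b' c' d' e' f'"
    using assms by (auto simp: quads_def)
  then have "(\<lambda>z. s * G z + t * H z) =
      quad (s * a + t * a') (s * b + t * b') (s * c + t * c')
        (s * d + t * d') (s * e + t * e') (s * f + t * f')"
    by (auto simp: quad_def algebra_simps)
  then show ?thesis
    by (simp only: quad_in_quads)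
qed

lemma affine_product_in_quads:
  "(\<lambda>z. (a * fst z + b * snd z + c) * (a' * fst z + b' * snd z + c')) \<in> quads"
proof -
  have "(\<lambda>z. (a * fst z + b * snd z + c) * (a' * fst z + b' * snd z + c')) =
      quad (a * a') (a * b' + b * a') (b * b') (a * c' + c * a') (b * c' + c * b') (c * c')"
    by (auto simp: quad_def algebra_simps power2_eq_square)
  then show ?thesis
    by (simp only: quad_in_quads)
qed

lemma area_product_in_quads: "(\<lambda>z. area p q z * area r s z) \<in> quads"
proof -
  have "area p q z =
      (snd p - snd q) * fst z + (fst q - fst p) * snd z + (snd q * fst p - fst q * snd p)" for p q z
    by (simp add: area_expand algebra_simps)
  then show ?thesis
    by (simp only: affine_product_in_quads)
qed

lemma quads_interpolation_formula:
  assumes G: "G \<in> quads" and "s + t + u = 1"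
  shows "G (s *\<^sub>R p + t *\<^sub>R q + u *\<^sub>R r) =
    s * (2 * s - 1) * G p + t * (2 * t - 1) * G q + u * (2 * u - 1) * G r
    + 4 * s * t * G (midpoint p q) + 4 * t * u * G (midpoint q r) + 4 * u * s * G (midpoint r p)"
proof -
  obtain a b c d e f where quad: "G = quad a b c d e f"
    using G by (auto simp: quads_def)
  have midpoint: "4 * G (midpoint x y) =
      a * (fst x + fst y)\<^sup>2 + b * (fst x + fst y) * (snd x + snd y)
      + c * (snd x + snd y)\<^sup>2 + 2 * d * (fst x + fst y) + 2 * e * (snd x + snd y) + 4 * f" for x y
    by (simp add: quad quad_def midpoint_def field_simps power2_eq_square)
  have "G (s *\<^sub>R p + t *\<^sub>R q + u *\<^sub>R r) =
      s * (2 * s - 1) * G p + t * (2 * t - 1) * G q + u * (2 * u - 1) * G r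
      + s * t * (4 * G (midpoint p q)) + t * u * (4 * G (midpoint q r))
      + u * s * (4 * G (midpoint r p))"
    using assms(2) unfolding midpoint
    unfolding quad quad_def fst_add snd_add fst_scaleR snd_scaleR real_scaleR_def by algebra
  then show ?thesis
    by (simp add: algebra_simps)
qed

lemma quads_zero_on_triangle:
  assumes G: "G \<in> quads" "G p = 0" "G q = 0" "G r = 0" and "area p q r \<noteq> 0"
  shows "(area p q r)\<^sup>2 * G z = 4 * (area q r z * area r p z * G (midpoint p q)
    + area r p z * area p q z * G (midpoint q r) + area p q z * area q r z * G (midpoint r p))"
proof -
  let ?A = "area p q r"
  have z: "z = (area q r z / ?A) *\<^sub>R p + (area r p z / ?A) *\<^sub>R q + (area p q z / ?A) *\<^sub>R r"
  proof -
    have "z = (1 / ?A) *\<^sub>R (?A *\<^sub>R z)"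
      using assms(5) by simp
    then show ?thesis
      unfolding area_barycentric[of p q r z] by (simp add: scaleR_add_right)
  qed
  have "area q r z / ?A + area r p z / ?A + area p q z / ?A = 1"
    using area_sum[of q r z p] assms(5) by (simp add: add_divide_distrib[symmetric])
  from quads_interpolation_formula[OF G(1) this, of p q r, folded z] show ?thesis
    using assms(5) G(2-4) by (simp add: field_simps power2_eq_square)
qed

lemma quads_eq_0:
  assumes G: "G \<in> quads" and line: "G p = 0" "G q = 0" "G (midpoint p q) = 0"
    and zero: "G x = 0" "G y = 0" "G w = 0"
    and off: "area p q x \<noteq> 0" "area p q y \<noteq> 0" "area p q w \<noteq> 0" "area x y w \<noteq> 0"
  shows "G z = 0"
proof -
  let ?E = "G (midpoint q x)" and ?F = "G (midpoint x p)"
  have factor: "(area p q x)\<^sup>2 * G z = 4 * area p q z * (area x p z * ?E + area q x z * ?F)" for z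
    using quads_zero_on_triangle[OF G line(1,2) zero(1) off(1)] line(3) by (simp add: algebra_simps)
  have y: "area x p y * ?E + area q x y * ?F = 0" and w: "area x p w * ?E + area q x w * ?F = 0"
    using factor[of y] factor[of w] zero off by simp_all
  have "area x p y * area q x w - area x p w * area q x y = - area p q x * area x y w"
    unfolding area_expand by algebra
  then have "area x p y * area q x w - area x p w * area q x y \<noteq> 0"
    using off by simp
  moreover have "(area x p y * area q x w - area x p w * area q x y) * ?E = 0"
    "(area x p y * area q x w - area x p w * area q x y) * ?F = 0"
    using y w by algebra+
  ultimately have "?E = 0" "?F = 0"
    by simp_all
  then show ?thesis
    using factor[of z] off(1) by simp
qed

text \<open>A quadratic function that vanishes on \<open>D\<close> is determined by its value at a sixth point, the
  midpoint of two points of \<open>D\<close>.\<close>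

lemma quads_proportional:
  assumes D: "general_position D" "card D = 5"
    and G: "G \<in> quads" "\<And>z. z \<in> D \<Longrightarrow> G z = 0" and H: "H \<in> quads" "\<And>z. z \<in> D \<Longrightarrow> H z = 0"
  shows "G x * H y = G y * H x"
proof -
  obtain p q r s t where p: "D = {p, q, r, s, t}" "distinct [p, q, r, s, t]"
    using card_5E[OF D(2)] .
  define m where "m = midpoint p q"
  have zero: "K z = 0" if K: "K \<in> quads" "\<And>z. z \<in> D \<Longrightarrow> K z = 0" "K m = 0" for K z
  proof (rule quads_eq_0[OF K(1), of p q r s t])
    show "area p q r \<noteq> 0" "area p q s \<noteq> 0" "area p q t \<noteq> 0" "area r s t \<noteq> 0"
      by (rule general_positionD[OF D(1)]; use p in auto)+
  qed (use K p m_def in auto)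
  have "(\<lambda>z. G m * H z + (- H m) * G z) \<in> quads"
    by (intro quads_combination G H)
  then have same_ratio: "G m * H z = H m * G z" for z
    using zero[of "\<lambda>z. G m * H z + (- H m) * G z" z] G(2) H(2) by auto
  show ?thesis
  proof (cases "G m = 0 \<and> H m = 0")
    case True
    then show ?thesis
      using zero[OF G] by simp
  next
    case False
    have "G m * (G x * H y - G y * H x) = 0" "H m * (G x * H y - G y * H x) = 0"
      using same_ratio[of x] same_ratio[of y] by algebra+
    with False show ?thesis
      by auto
  qed
qed

lemma quads_interpolate:
  assumes "general_position (insert g D)" "card D = 4" "g \<notin> D"
  shows "\<exists>H\<in>quads. (\<forall>x\<in>D. H x = 0) \<and> H g = 1"
proof -
  obtain p q r s where p: "D = {p, q, r, s}" "distinct [p, q, r, s]"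
    using card_4E[OF assms(2)] .
  define k where "k = area p q g * area r s g"
  have "area p q g \<noteq> 0" "area r s g \<noteq> 0"
    by (rule general_positionD[OF assms(1)]; use p assms(3) in auto)+
  then have k: "k \<noteq> 0"
    by (simp add: k_def)
  define H where "H = (\<lambda>z. area p q z * area r s z / k)"
  have "H \<in> quads"
    using quads_combination[OF area_product_in_quads area_product_in_quads, of "1 / k" p q r s 0]
    by (simp add: H_def)
  moreover have "\<forall>x\<in>D. H x = 0" "H g = 1"
    using p(1) k by (auto simp: H_def k_def)
  ultimately show ?thesis
    by blast
qed

lemma quads_through_five:
  assumes D: "general_position D" "card D = 5"
  shows "\<exists>G\<in>quads. (\<forall>x\<in>D. G x = 0) \<and> (\<exists>z. G z \<noteq> 0)"
proof -
  obtain p q r s t where p: "D = {p, q, r, s, t}" "distinct [p, q, r, s, t]"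
    using card_5E[OF D(2)] .
  define H1 where "H1 z = area p q z * area r s z" for z
  define H2 where "H2 z = area p r z * area q s z" for z
  \<comment> \<open>the member through \<open>t\<close> of the pencil spanned by two line pairs through \<open>p, q, r, s\<close>\<close>
  define G where "G z = H2 t * H1 z + (- H1 t) * H2 z" for z
  have "H1 \<in> quads" "H2 \<in> quads"
    unfolding H1_def H2_def by (rule area_product_in_quads)+
  then have "G \<in> quads"
    unfolding G_def by (rule quads_combination)
  moreover have "G x = 0" if "x \<in> D" for x
    using that by (auto simp: p(1) G_def H1_def H2_def)
  moreover have "G (midpoint p q) \<noteq> 0"
  proof -
    have "area p r q \<noteq> 0" "area q s p \<noteq> 0" "area p q t \<noteq> 0" "area r s t \<noteq> 0"
      by (rule general_positionD[OF D(1)]; use p in auto)+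
    then show ?thesis
      by (simp add: G_def H1_def H2_def area_midpoint)
  qed
  ultimately show ?thesis
    by blast
qed

section \<open>Conics in the plane\<close>

lemma quad_degree_2:
  assumes "area p q r \<noteq> 0"
    and zero: "quad a b c d e f p = 0" "quad a b c d e f q = 0" "quad a b c d e f r = 0"
    and "quad a b c d e f z \<noteq> 0"
  shows "(a, b, c) \<noteq> (0, 0, 0)"
proof
  let ?G = "quad a b c d e f"
  assume "(a, b, c) = (0, 0, 0)"
  then have midpoint: "?G (midpoint x y) = (?G x + ?G y) / 2" for x y
    by (simp add: quad_def midpoint_def field_simps)
  have "?G (midpoint p q) = 0" "?G (midpoint q r) = 0" "?G (midpoint r p) = 0"
    by (simp_all add: midpoint zero)
  then have "(area p q r)\<^sup>2 * ?G z = 0"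
    using quads_zero_on_triangle[OF quad_in_quads zero assms(1)] by simp
  then show False
    using assms(1,5) by simp
qed

lemma plane_conic_iff:
  "plane_conic Q \<longleftrightarrow> (\<exists>a b c d e f. (a, b, c) \<noteq> (0, 0, 0) \<and> Q = {z. quad a b c d e f z = 0})"
proof -
  have "{z. quad a b c d e f z = 0} =
      {(x, y). a * x\<^sup>2 + b * x * y + c * y\<^sup>2 + d * x + e * y + f = 0}"
    for a b c d e f
    by (auto simp: quad_def)
  then show ?thesis
    by (simp only: plane_conic_def)
qed

lemma plane_conic_zero_set:
  assumes "G \<in> quads" "area p q r \<noteq> 0" "G p = 0" "G q = 0" "G r = 0" "G z \<noteq> 0"
  shows "plane_conic {z. G z = 0}"
proof -
  obtain a b c d e f where G: "G = quad a b c d e f"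
    using assms(1) by (auto simp: quads_def)
  then have "(a, b, c) \<noteq> (0, 0, 0)"
    using quad_degree_2[OF assms(2), of a b c d e f z] assms(3-) by simp
  then show ?thesis
    unfolding plane_conic_iff G by blast
qed

lemma plane_conicE:
  assumes "plane_conic Q"
  obtains G where "G \<in> quads" "Q = {z. G z = 0}"
  using assms quad_in_quads unfolding plane_conic_iff by blast

locale conic_free =
  fixes S :: "(real \<times> real) set"
  assumes finite_points: "finite S" and seven_points: "7 \<le> card S"
    and no_conic: "\<nexists>Q. plane_conic Q \<and> S \<subseteq> Q"
    and general_position: "general_position S"
begin

lemma plane_conic_if_zero_on_five:
  assumes D: "D \<subseteq> S" "card D = 5" and G: "G \<in> quads" "\<And>x. x \<in> D \<Longrightarrow> G x = 0" "G z \<noteq> 0"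
  shows "plane_conic {z. G z = 0}"
proof -
  obtain p q r s t where p: "D = {p, q, r, s, t}" "distinct [p, q, r, s, t]"
    using card_5E[OF D(2)] .
  then have "area p q r \<noteq> 0"
    using D(1) by (intro general_positionD[OF general_position]) auto
  then show ?thesis
    using G p(1) by (intro plane_conic_zero_set[of G p q r]) auto
qed

sublocale conic_system S quads
proof
  show "finite S" "7 \<le> card S"
    by (fact finite_points seven_points)+
  show "(\<lambda>x. s * G x + t * H x) \<in> quads" if "G \<in> quads" "H \<in> quads" for G H s t
    using that by (rule quads_combination)
  show "G x * H y = G y * H x" if "D \<subseteq> S" "card D = 5" "G \<in> quads" "H \<in> quads"
    "\<And>z. z \<in> D \<Longrightarrow> G z = 0" "\<And>z. z \<in> D \<Longrightarrow> H z = 0" for D G H x y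
    using quads_proportional general_position_subset[OF general_position] that by blast
  show "\<exists>H\<in>quads. (\<forall>x\<in>D. H x = 0) \<and> H g = 1" if "D \<subseteq> S" "card D = 4" "g \<in> S - D" for D g
    using that by (intro quads_interpolate general_position_subset[OF general_position]) auto
  show "\<exists>G\<in>quads. (\<forall>x\<in>D. G x = 0) \<and> (\<exists>x\<in>S. G x \<noteq> 0)" if D: "D \<subseteq> S" "card D = 5" for D
  proof -
    obtain G z where G: "G \<in> quads" "\<And>x. x \<in> D \<Longrightarrow> G x = 0" "G z \<noteq> 0"
      using quads_through_five[OF general_position_subset[OF general_position D(1)] D(2)] by blast
    then show ?thesis
      using plane_conic_if_zero_on_five[OF D G] no_conic by blast
  qed
qed

lemma zero_set_Int:
  assumes "\<Gamma> \<in> ordinary"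
  shows "{z. equation \<Gamma> z = 0} \<inter> S = \<Gamma>"
  using cuts_out_equation[OF assms] ordinaryD(1)[OF assms] by (auto simp: cuts_out_def)

lemma zero_set_unique:
  assumes "\<Gamma> \<in> ordinary" "plane_conic Q" "\<Gamma> \<subseteq> Q"
  shows "Q = {z. equation \<Gamma> z = 0}"
proof -
  note \<Gamma> = ordinaryD[OF assms(1)] and E = cuts_out_equation[OF assms(1)]
  obtain G where G: "G \<in> quads" "Q = {z. G z = 0}"
    using plane_conicE[OF assms(2)] .
  have zero: "equation \<Gamma> z = 0" "G z = 0" if "z \<in> \<Gamma>" for z
    using that assms(3) G(2) E \<Gamma>(1) by (auto simp: cuts_out_def)
  have equation_in: "equation \<Gamma> \<in> quads"
    using E by (simp add: cuts_out_def)
  have proportional_G: "equation \<Gamma> x * G y = equation \<Gamma> y * G x" for x y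
    using quads_proportional[OF general_position_subset[OF general_position \<Gamma>(1)] \<Gamma>(2)
      equation_in zero(1) G(1) zero(2)] .
  obtain w where "G w \<noteq> 0"
    using no_conic assms(2) G(2) by blast
  moreover obtain y where "equation \<Gamma> y \<noteq> 0"
    using cuts_out_nonzero[OF assms(1) E] .
  ultimately have "G x = 0 \<longleftrightarrow> equation \<Gamma> x = 0" for x
    using proportional_G[of x w] proportional_G[of x y] by auto
  then show ?thesis
    using G(2) by simp
qed

lemma ordinary_conic_zero_set:
  assumes "\<Gamma> \<in> ordinary"
  shows "ordinary_conic S {z. equation \<Gamma> z = 0}"
proof -
  note \<Gamma> = ordinaryD[OF assms] and E = cuts_out_equation[OF assms]
  obtain y where "equation \<Gamma> y \<noteq> 0"
    using cuts_out_nonzero[OF assms E] .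
  then have "plane_conic {z. equation \<Gamma> z = 0}"
    using \<Gamma>(1) E by (intro plane_conic_if_zero_on_five[OF \<Gamma>(1,2)]) (auto simp: cuts_out_def)
  then show ?thesis
    unfolding ordinary_conic_def zero_set_Int[OF assms]
    using \<Gamma>(2) zero_set_unique[OF assms] by blast
qed

theorem choose_4_le_card_ordinary_conics: "card S choose 4 \<le> 5 * card {Q. ordinary_conic S Q}"
proof -
  have "inj_on (\<lambda>\<Gamma>. {z. equation \<Gamma> z = 0}) ordinary"
    by (rule inj_on_inverseI[of _ "\<lambda>Q. Q \<inter> S"]) (rule zero_set_Int)
  then have "card ordinary \<le> card {Q. ordinary_conic S Q}"
    using ordinary_conic_zero_set finite_ordinary_conics[OF finite_points]
    by (intro card_inj_on_le) auto
  then show ?thesis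
    using choose_4_le_card_ordinary by linarith
qed

end

lemma power_4_le_choose_4: "real n ^ 4 - 6 * real n ^ 3 \<le> 24 * real (n choose 4)"
proof -
  have "24 * real (n choose 4) = real n * (real n - 1) * (real n - 2) * (real n - 3)"
    by (simp add: binomial_gbinomial gbinomial_prod_rev eval_nat_numeral fact_prod)
  also have "\<dots> = real n ^ 4 - 6 * real n ^ 3 + real n * (11 * real n - 6)"
    by algebra
  finally show ?thesis
    by (cases n) auto
qed

theorem theorem5p1:
  "\<exists>C::real. \<forall>S::(real \<times> real) set.
     finite S \<and> (\<nexists>Q. plane_conic Q \<and> S \<subseteq> Q) \<and>
     (\<forall>T\<subseteq>S. card T = 3 \<longrightarrow> \<not> collinear T) \<longrightarrow>
     real (card {Q. ordinary_conic S Q}) \<ge> 1 / 120 * real (card S) ^ 4 - C * real (card S) ^ 3"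
proof (intro exI[of _ "1 / 20"] allI impI)
  fix S :: "(real \<times> real) set"
  assume S: "finite S \<and> (\<nexists>Q. plane_conic Q \<and> S \<subseteq> Q) \<and> (\<forall>T\<subseteq>S. card T = 3 \<longrightarrow> \<not> collinear T)"
  show "1 / 120 * real (card S) ^ 4 - 1 / 20 * real (card S) ^ 3
      \<le> real (card {Q. ordinary_conic S Q})"
  proof (cases "7 \<le> card S")
    case True
    then interpret conic_free S
      using S general_position_if_no_three_collinear by unfold_locales blast+
    have "real (card S choose 4) \<le> 5 * real (card {Q. ordinary_conic S Q})"
      using choose_4_le_card_ordinary_conics by (metis of_nat_le_iff of_nat_mult of_nat_numeral)
    then show ?thesis
      using power_4_le_choose_4[of "card S"] by linarith
  next
    case False
    then have "real (card S) * real (card S) ^ 3 \<le> 6 * real (card S) ^ 3"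
      by (intro mult_right_mono) simp_all
    then have "real (card S) ^ 4 \<le> 6 * real (card S) ^ 3"
      by (simp add: eval_nat_numeral)
    then show ?thesis
      using of_nat_0_le_iff[of "card {Q. ordinary_conic S Q}", where 'a = real] by linarith
  qed
qed

end
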